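(* Let $(W,S)$ be a finite Coxeter system, $c$ a Coxeter element with reduced word $\mathbf{c}$, and $\mathbf{w}_\circ(\mathbf{c})$ the $c$-sorting word of $w_\circ$. Let $s,t\in S$ be neighbors in the Coxeter graph such that $s$ comes before $t$ in $c$. Then $\phi_{\mathbf{w}_\circ(\mathbf{c})}(s)=\phi_{\mathbf{w}_\circ(\mathbf{c})}(t)$ if $\psi(s)$ comes before $\psi(t)$ in $c$, and $\phi_{\mathbf{w}_\circ(\mathbf{c})}(s)=\phi_{\mathbf{w}_\circ(\mathbf{c})}(t)+1$ if $\psi(s)$ comes after $\psi(t)$ in $c$.
   Context: A Coxeter element is the product of all elements of $S$ in some order. $s,t$ are neighbors in the Coxeter graph if they do not commute. For non-commuting $s,t$, "$s$ comes before $t$ in $c$" means $s$ appears before $t$ in any (equivalently every) reduced expression of $c$. $w_\circ$ is the longest element and $\psi(s)=w_\circ^{-1}sw_\circ$. $\mathbf{w}_\circ(\mathbf{c})$ is the lexicographically first (as a sequence of positions) subword of $\mathbf{c}\mathbf{c}\mathbf{c}\cdots$ which is a reduced expression for $w_\circ$. For a word $\mathbf{w}$ in $S$, $\phi_{\mathbf{w}}(s)$ is the number of occurrences of the letter $s$ in $\mathbf{w}$. *)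

theory Defs
  imports "HOL-Algebra.Multiplicative_Group" "HOL-Algebra.Generated_Groups"
begin

definition word_prod :: "('a, 'b) monoid_scheme \<Rightarrow> 'a list \<Rightarrow> 'a" where
  "word_prod W ws = foldr (\<otimes>\<^bsub>W\<^esub>) ws \<one>\<^bsub>W\<^esub>"

text \<open>
  One application of a Coxeter relation \<open>(s t)\<^sup>m = 1\<close>, where \<open>m\<close> is the order of \<open>s t\<close> in \<open>W\<close>.
  For \<open>s = t\<close> the order is \<open>1\<close> and this deletes a factor \<open>s s\<close>.  An element of infinite order has
  \<^const>\<open>group.ord\<close> equal to \<open>0\<close>, so that such a pair contributes only a trivial relation.
\<close>

inductive coxeter_step :: "('a, 'b) monoid_scheme \<Rightarrow> 'a set \<Rightarrow> 'a list \<Rightarrow> 'a list \<Rightarrow> bool"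
  for W :: "('a, 'b) monoid_scheme" and S :: "'a set" where
  "s \<in> S \<Longrightarrow> t \<in> S \<Longrightarrow> u \<in> lists S \<Longrightarrow> v \<in> lists S \<Longrightarrow>
    coxeter_step W S (u @ concat (replicate (group.ord W (s \<otimes>\<^bsub>W\<^esub> t)) [s, t]) @ v) (u @ v)"

text \<open>
  The last assumption says that \<open>W\<close> is presented by the generators \<open>S\<close> and the relations
  \<open>(s t)\<^bsup>m(s,t)\<^esup> = 1\<close>.  Words without formal inverses suffice because \<open>s s = 1\<close> is among
  the relations, so that the monoid and the group with this presentation coincide.
\<close>

locale coxeter_system = group W for W (structure) +
  fixes S :: "'a set"
  assumes S_subset: "S \<subseteq> carrier W"
    and S_generates: "generate W S = carrier W"
    and S_order: "\<And>s. s \<in> S \<Longrightarrow> ord s = 2"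
    and presentation: "\<And>u v. u \<in> lists S \<Longrightarrow> v \<in> lists S \<Longrightarrow>
      word_prod W u = word_prod W v \<longleftrightarrow> equivclp (coxeter_step W S) u v"

definition cox_length :: "('a, 'b) monoid_scheme \<Rightarrow> 'a set \<Rightarrow> 'a \<Rightarrow> nat" where
  "cox_length W S w = (LEAST n. \<exists>ws \<in> lists S. word_prod W ws = w \<and> length ws = n)"

definition reduced_word :: "('a, 'b) monoid_scheme \<Rightarrow> 'a set \<Rightarrow> 'a \<Rightarrow> 'a list \<Rightarrow> bool" where
  "reduced_word W S w ws \<longleftrightarrow>
    ws \<in> lists S \<and> word_prod W ws = w \<and> length ws = cox_length W S w"

definition coxeter_element :: "('a, 'b) monoid_scheme \<Rightarrow> 'a set \<Rightarrow> 'a \<Rightarrow> bool" where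
  "coxeter_element W S c \<longleftrightarrow> (\<exists>ws. distinct ws \<and> set ws = S \<and> word_prod W ws = c)"

definition longest_element :: "('a, 'b) monoid_scheme \<Rightarrow> 'a set \<Rightarrow> 'a \<Rightarrow> bool" where
  "longest_element W S w \<longleftrightarrow>
    w \<in> carrier W \<and> (\<forall>v \<in> carrier W. cox_length W S v \<le> cox_length W S w)"

definition neighbors :: "('a, 'b) monoid_scheme \<Rightarrow> 'a set \<Rightarrow> 'a \<Rightarrow> 'a \<Rightarrow> bool" where
  "neighbors W S s t \<longleftrightarrow> s \<in> S \<and> t \<in> S \<and> s \<otimes>\<^bsub>W\<^esub> t \<noteq> t \<otimes>\<^bsub>W\<^esub> s"

text \<open>
  For non-commuting \<open>s\<close> and \<open>t\<close> in \<open>S\<close> and a Coxeter element \<open>c\<close>, the order of \<open>s\<close> and \<open>t\<close> is the same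
  in all reduced words of \<open>c\<close>.  The existential reading is the weaker condition a priori, hence the
  stronger theorem when it is used as a hypothesis.
\<close>

definition comes_before :: "('a, 'b) monoid_scheme \<Rightarrow> 'a set \<Rightarrow> 'a \<Rightarrow> 'a \<Rightarrow> 'a \<Rightarrow> bool" where
  "comes_before W S c s t \<longleftrightarrow>
    (\<exists>ws. reduced_word W S c ws \<and> (\<exists>i j. i < j \<and> j < length ws \<and> ws ! i = s \<and> ws ! j = t))"

definition psi :: "('a, 'b) monoid_scheme \<Rightarrow> 'a \<Rightarrow> 'a \<Rightarrow> 'a" where
  "psi W w0 s = inv\<^bsub>W\<^esub> w0 \<otimes>\<^bsub>W\<^esub> s \<otimes>\<^bsub>W\<^esub> w0"

text \<open>The subword of the infinite word \<open>cs cs cs \<dots>\<close> at the positions \<open>ps\<close> (counted from \<open>0\<close>).\<close>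

definition power_subword :: "'a list \<Rightarrow> nat list \<Rightarrow> 'a list" where
  "power_subword cs ps = map (\<lambda>i. cs ! (i mod length cs)) ps"

definition reduced_positions ::
  "('a, 'b) monoid_scheme \<Rightarrow> 'a set \<Rightarrow> 'a list \<Rightarrow> 'a \<Rightarrow> nat list \<Rightarrow> bool" where
  "reduced_positions W S cs w ps \<longleftrightarrow>
    sorted_wrt (<) ps \<and> reduced_word W S w (power_subword cs ps)"

definition sorting_word ::
  "('a, 'b) monoid_scheme \<Rightarrow> 'a set \<Rightarrow> 'a list \<Rightarrow> 'a \<Rightarrow> 'a list \<Rightarrow> bool" where
  "sorting_word W S cs w ws \<longleftrightarrow>
    (\<exists>ps. reduced_positions W S cs w ps \<and>
       (\<forall>qs. reduced_positions W S cs w qs \<longrightarrow> qs = ps \<or> (ps, qs) \<in> lexord less_than) \<and>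
       ws = power_subword cs ps)"

end

theory Submission
  imports Defs Complex_Main
begin

text \<open>
  Since every element extends to \<open>w0\<close>, the sorting word of \<open>w0\<close> is greedy: a letter \<open>r\<close> of the
  infinite word \<open>cs cs cs \<dots>\<close> is taken iff it lengthens the product \<open>g\<close> of the letters taken so far.

  A skipped letter \<open>a\<close> satisfies \<open>g (alpha a) < 0\<close>. As long as no neighbor of a skipped letter has
  been taken, taking letters amounts to firing sources of the orientation of the Coxeter graph
  given by \<open>c\<close>, and firing a source preserves the associated skew form up to the action of \<open>W\<close>. Since
  a source pairs nonnegatively with all positive roots, a skipped letter that precedes a neighbor \<open>b\<close>
  forces \<open>b\<close> to be skipped too. So the whole sorting word is a firing sequence, in which the
  neighbors \<open>s\<close> and \<open>t\<close> alternate, starting with \<open>s\<close>.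

  Firing \<open>r\<close> conjugates the Coxeter element by \<open>r\<close>, hence the final orientation belongs to
  \<open>inv w0 c w0 = psi c\<close>. It tells which of \<open>s\<close> and \<open>t\<close> comes last in the sorting word.
\<close>

section \<open>Words and length\<close>

context coxeter_system
begin

abbreviation wprod :: "'a list \<Rightarrow> 'a" where "wprod \<equiv> word_prod W"

abbreviation len :: "'a \<Rightarrow> nat" where "len \<equiv> cox_length W S"

lemma wprod_Nil [simp]: "wprod [] = \<one>"
  by (simp add: word_prod_def)

lemma wprod_Cons [simp]: "wprod (x # u) = x \<otimes> wprod u"
  by (simp add: word_prod_def)

lemma S_carrier [simp]: "s \<in> S \<Longrightarrow> s \<in> carrier W"
  using S_subset by blast

lemma wprod_closed [simp]: "set u \<subseteq> S \<Longrightarrow> wprod u \<in> carrier W"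
  by (induction u) auto

lemma wprod_append [simp]:
  "set u \<subseteq> S \<Longrightarrow> set v \<subseteq> S \<Longrightarrow> wprod (u @ v) = wprod u \<otimes> wprod v"
  by (induction u) (auto simp: m_assoc)

lemma S_involution [simp]: "s \<in> S \<Longrightarrow> s \<otimes> s = \<one>"
  using pow_ord_eq_1[of s] S_order[of s] by (simp add: numeral_2_eq_2)

lemma S_involution_assoc [simp]: "s \<in> S \<Longrightarrow> x \<in> carrier W \<Longrightarrow> s \<otimes> (s \<otimes> x) = x"
  using m_assoc[of s s x] by simp

lemma S_inv [simp]: "s \<in> S \<Longrightarrow> inv s = s"
  by (simp add: inv_equality)

lemma wprod_rev: "set u \<subseteq> S \<Longrightarrow> wprod (rev u) = inv (wprod u)"
  by (induction u) (auto simp: inv_mult_group)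

lemma ex_word:
  assumes "w \<in> carrier W"
  shows "\<exists>u. set u \<subseteq> S \<and> wprod u = w"
proof -
  have "w \<in> generate W S" using assms S_generates by simp
  then show ?thesis
  proof induction
    case one
    show ?case by (intro exI[of _ "[]"]) simp
  next
    case (incl h)
    then show ?case by (intro exI[of _ "[h]"]) simp
  next
    case (inv h)
    then show ?case by (intro exI[of _ "[h]"]) simp
  next
    case (eng h1 h2)
    then obtain u v where "set u \<subseteq> S" "wprod u = h1" "set v \<subseteq> S" "wprod v = h2" by blast
    then show ?case by (intro exI[of _ "u @ v"]) simp
  qed
qed

lemma len_le: "set u \<subseteq> S \<Longrightarrow> len (wprod u) \<le> length u"
  unfolding cox_length_def by (rule Least_le) (auto simp: in_lists_conv_set)

lemma ex_reduced:
  assumes "w \<in> carrier W"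
  shows "\<exists>u. set u \<subseteq> S \<and> wprod u = w \<and> length u = len w"
proof -
  have "\<exists>n. \<exists>u\<in>lists S. wprod u = w \<and> length u = n"
    using ex_word[OF assms] by (metis in_lists_conv_set subset_code(1))
  from LeastI_ex[OF this] show ?thesis
    unfolding cox_length_def by (auto simp: in_lists_conv_set)
qed

lemma len_mult_le:
  assumes "v \<in> carrier W" "w \<in> carrier W"
  shows "len (v \<otimes> w) \<le> len v + len w"
proof -
  obtain a b where "set a \<subseteq> S" "wprod a = v" "length a = len v"
    "set b \<subseteq> S" "wprod b = w" "length b = len w"
    using ex_reduced assms by metis
  then show ?thesis using len_le[of "a @ b"] by simp
qed

lemma len_inv:
  assumes "w \<in> carrier W"
  shows "len (inv w) = len w"
proof -
  have le: "len (inv v) \<le> len v" if "v \<in> carrier W" for v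
    using ex_reduced[OF that] len_le wprod_rev by (metis length_rev set_rev)
  show ?thesis using le[OF assms] le[of "inv w"] assms by simp
qed

lemma coxeter_step_parity: "coxeter_step W S u v \<Longrightarrow> even (length u) = even (length v)"
  by (induction rule: coxeter_step.induct) (simp add: length_concat sum_list_replicate)

text \<open>Every relator has even length \<open>2 * ord (s \<otimes> t)\<close>, so passing between
  words with the same product preserves parity. This is the sign character.\<close>

lemma wprod_parity:
  assumes "set u \<subseteq> S" "set v \<subseteq> S" "wprod u = wprod v"
  shows "even (length u) = even (length v)"
proof -
  have "equivclp (coxeter_step W S) u v"
    using presentation[of u v] assms by (auto simp: in_lists_conv_set)
  then show ?thesis
    by (induction rule: equivclp_induct) (auto dest: coxeter_step_parity)
qed

text \<open>One letter changes the length by at most one, and parity rules out no change.\<close>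

lemma len_mult_S:
  assumes "w \<in> carrier W" "s \<in> S"
  shows "len (w \<otimes> s) = Suc (len w) \<or> len w = Suc (len (w \<otimes> s))"
proof -
  obtain u v where u: "set u \<subseteq> S" "wprod u = w" "length u = len w"
    and v: "set v \<subseteq> S" "wprod v = w \<otimes> s" "length v = len (w \<otimes> s)"
    using ex_reduced[of w] ex_reduced[of "w \<otimes> s"] assms by auto
  have "even (length (u @ [s])) = even (length v)"
    using u v assms by (intro wprod_parity) auto
  moreover have "length v \<le> length u + 1"
    using len_le[of "u @ [s]"] u v assms by simp
  moreover have "length u \<le> length v + 1"
    using len_le[of "v @ [s]"] u v assms by (simp add: m_assoc)
  ultimately show ?thesis using u v
    by simp presburger
qed

lemma len_one [simp]: "len \<one> = 0"
  using len_le[of "[]"] by simp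

lemma len_0_iff: "w \<in> carrier W \<Longrightarrow> len w = 0 \<longleftrightarrow> w = \<one>"
  using ex_reduced[of w] by force

lemma S_not_one: "s \<in> S \<Longrightarrow> s \<noteq> \<one>"
  using S_order by force

lemma ex_S_of_len_1:
  assumes "w \<in> carrier W" "len w = 1"
  shows "w \<in> S"
proof -
  obtain u where u: "set u \<subseteq> S" "wprod u = w" "length u = Suc 0"
    using ex_reduced[OF assms(1)] assms(2) by auto
  then obtain x where "u = [x]" by (auto simp: length_Suc_conv)
  then show ?thesis using u by auto
qed

definition reduced :: "'a list \<Rightarrow> bool" where
  "reduced u \<longleftrightarrow> set u \<subseteq> S \<and> len (wprod u) = length u"

lemma reduced_word_iff: "reduced_word W S w u \<longleftrightarrow> reduced u \<and> wprod u = w"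
  by (auto simp: reduced_word_def reduced_def in_lists_conv_set)

text \<open>By subadditivity of \<open>len\<close>, a shorter expression of either factor would
  shorten the whole word.\<close>

lemma reduced_appendD:
  assumes "reduced (u @ v)"
  shows "reduced u" "reduced v"
proof -
  have sub: "set u \<subseteq> S" "set v \<subseteq> S" using assms by (auto simp: reduced_def)
  have "length u + length v \<le> len (wprod u) + len (wprod v)"
    using assms sub len_mult_le[of "wprod u" "wprod v"] by (simp add: reduced_def)
  then show "reduced u" "reduced v"
    using len_le[OF sub(1)] len_le[OF sub(2)] sub by (auto simp: reduced_def)
qed

end

section \<open>The geometric representation\<close>

text \<open>The simple roots. Vectors are coordinate functions with respect to them, on the whole
  type; words in \<open>S\<close> move only the coordinates in \<open>S\<close>.\<close>

definition alpha :: "'a \<Rightarrow> 'a \<Rightarrow> real" where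
  "alpha s = (\<lambda>x. if x = s then 1 else 0)"

definition pos :: "('a \<Rightarrow> real) \<Rightarrow> bool" where "pos v \<longleftrightarrow> (\<forall>x. 0 \<le> v x)"

definition neg :: "('a \<Rightarrow> real) \<Rightarrow> bool" where "neg v \<longleftrightarrow> (\<forall>x. v x \<le> 0)"

text \<open>The word ends in \<open>t\<close>; its first letter depends on the parity of \<open>k\<close>.\<close>

fun alt :: "nat \<Rightarrow> 'a \<Rightarrow> 'a \<Rightarrow> 'a list" where
  "alt 0 s t = []"
| "alt (Suc k) s t = (if even k then t else s) # alt k s t"

lemma length_alt [simp]: "length (alt k s t) = k"
  by (induction k) auto

lemma set_alt: "set (alt k s t) \<subseteq> {s, t}"
  by (induction k) auto

lemma alt_snoc: "alt k s t @ [s] = alt (Suc k) t s"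
  by (induction k) auto

lemma drop_alt: "drop i (alt (i + j) s t) = alt j s t"
  by (induction i) auto

lemma concat_replicate_eq_alt: "concat (replicate m [s, t]) = alt (2 * m) s t"
  by (induction m) auto

text \<open>Along an arithmetic progression, sine and cosine obey the three-term recurrence that two
  alternating reflections impose on coordinates.\<close>

lemma sin_cos_step:
  fixes x y :: real
  shows "sin (x + 2 * y) = 2 * cos y * sin (x + y) - sin x"
    and "cos (x + 2 * y) = 2 * cos y * cos (x + y) - cos x"
proof -
  have "x + 2 * y = (x + y) + y" by simp
  then show "sin (x + 2 * y) = 2 * cos y * sin (x + y) - sin x"
    and "cos (x + 2 * y) = 2 * cos y * cos (x + y) - cos x"
    using sin_add[of "x + y" y] sin_diff[of "x + y" y] cos_add[of "x + y" y] cos_diff[of "x + y" y]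
    by (simp_all add: ac_simps)
qed

context coxeter_system
begin

text \<open>For \<open>s t\<close> of infinite order the value is \<open>- cos (pi / 0) = - cos 0 = - 1\<close>, as it should be.\<close>

definition bil :: "'a \<Rightarrow> 'a \<Rightarrow> real" where
  "bil s t = - cos (pi / real (ord (s \<otimes> t)))"

text \<open>The canonical bilinear form with the simple root of \<open>s\<close> as first
  argument.\<close>

definition pair :: "'a \<Rightarrow> ('a \<Rightarrow> real) \<Rightarrow> real" where
  "pair s v = (\<Sum>t\<in>S. bil s t * v t)"

definition reflect :: "'a \<Rightarrow> ('a \<Rightarrow> real) \<Rightarrow> 'a \<Rightarrow> real" where
  "reflect s v = v(s := v s - 2 * pair s v)"

text \<open>Indexed by words; that it depends only on the product in \<open>W\<close> is
  \<open>act_cong\<close>.\<close>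

definition act :: "'a list \<Rightarrow> ('a \<Rightarrow> real) \<Rightarrow> 'a \<Rightarrow> real" where
  "act u v = foldr reflect u v"

lemma act_Nil [simp]: "act [] v = v"
  and act_Cons [simp]: "act (x # u) v = reflect x (act u v)"
  and act_append [simp]: "act (u @ u') v = act u (act u' v)"
  by (simp_all add: act_def)

lemma ord_prod_comm:
  assumes "s \<in> S" "t \<in> S"
  shows "ord (s \<otimes> t) = ord (t \<otimes> s)"
  using ord_inv[of "s \<otimes> t"] assms by (simp add: inv_mult_group)

lemma bil_comm: "s \<in> S \<Longrightarrow> t \<in> S \<Longrightarrow> bil s t = bil t s"
  using ord_prod_comm by (simp add: bil_def)

lemma bil_same [simp]: "s \<in> S \<Longrightarrow> bil s s = 1"
  by (simp add: bil_def)

lemma prod_eq_one_iff: "s \<in> S \<Longrightarrow> t \<in> S \<Longrightarrow> s \<otimes> t = \<one> \<longleftrightarrow> s = t"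
  by (metis S_carrier S_inv S_involution inv_equality)

lemma ord_neq_one: "s \<in> S \<Longrightarrow> t \<in> S \<Longrightarrow> s \<noteq> t \<Longrightarrow> ord (s \<otimes> t) \<noteq> 1"
  using ord_eq_1[of "s \<otimes> t"] prod_eq_one_iff by simp

lemma ord_two_iff_commute:
  assumes "s \<in> S" "t \<in> S" "s \<noteq> t"
  shows "ord (s \<otimes> t) = 2 \<longleftrightarrow> s \<otimes> t = t \<otimes> s"
proof
  assume "ord (s \<otimes> t) = 2"
  then have "(s \<otimes> t) \<otimes> (s \<otimes> t) = \<one>"
    using pow_ord_eq_1[of "s \<otimes> t"] assms by (simp add: numeral_2_eq_2)
  then have "inv (s \<otimes> t) = s \<otimes> t" using assms by (intro inv_equality) auto
  then show "s \<otimes> t = t \<otimes> s" using assms by (simp add: inv_mult_group)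
next
  assume "s \<otimes> t = t \<otimes> s"
  then have "(s \<otimes> t) \<otimes> (s \<otimes> t) = (s \<otimes> t) \<otimes> (t \<otimes> s)" by simp
  then have "(s \<otimes> t) [^] (2::nat) = \<one>"
    using assms by (simp add: numeral_2_eq_2 m_assoc)
  then have "ord (s \<otimes> t) dvd 2" using assms pow_eq_id[of "s \<otimes> t" 2] by simp
  then have "ord (s \<otimes> t) \<le> 2" "ord (s \<otimes> t) \<noteq> 0"
    by (auto dest: dvd_imp_le intro!: Nat.gr0I)
  then show "ord (s \<otimes> t) = 2" using ord_neq_one[OF assms] by linarith
qed

lemma bil_commute_eq_0:
  "s \<in> S \<Longrightarrow> t \<in> S \<Longrightarrow> s \<noteq> t \<Longrightarrow> s \<otimes> t = t \<otimes> s \<Longrightarrow> bil s t = 0"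
  using ord_two_iff_commute[of s t] by (simp add: bil_def)

lemma bil_neg:
  assumes "s \<in> S" "t \<in> S" "s \<otimes> t \<noteq> t \<otimes> s"
  shows "bil s t < 0"
proof -
  have ne: "s \<noteq> t" using assms by auto
  have *: "ord (s \<otimes> t) \<noteq> 1" "ord (s \<otimes> t) \<noteq> 2"
    using ord_neq_one ord_two_iff_commute assms ne by auto
  show ?thesis
  proof (cases "ord (s \<otimes> t) = 0")
    case False
    then have "ord (s \<otimes> t) > 2" using * by linarith
    then have "cos (pi / real (ord (s \<otimes> t))) > 0"
      by (intro cos_gt_zero) (auto simp: field_simps)
    then show ?thesis by (simp add: bil_def)
  qed (simp add: bil_def)
qed

lemma bil_nonpos: "s \<in> S \<Longrightarrow> t \<in> S \<Longrightarrow> s \<noteq> t \<Longrightarrow> bil s t \<le> 0"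
  using bil_neg[of s t] bil_commute_eq_0[of s t] by force

lemma pair_lin: "pair s (\<lambda>x. a * u x + b * v x) = a * pair s u + b * pair s v"
  by (simp add: pair_def sum.distrib sum_distrib_left algebra_simps)

lemma reflect_lin: "reflect s (\<lambda>x. a * u x + b * v x) = (\<lambda>x. a * reflect s u x + b * reflect s v x)"
  by (auto simp: reflect_def pair_lin algebra_simps)

lemma act_lin: "act w (\<lambda>x. a * u x + b * v x) = (\<lambda>x. a * act w u x + b * act w v x)"
  by (induction w) (auto simp: reflect_lin)

lemma act_zero [simp]: "act w (\<lambda>x. 0) = (\<lambda>x. 0)"
  using act_lin[of w 0 "\<lambda>x. 0" 0 "\<lambda>x. 0"] by simp

lemma act_uminus: "act w (\<lambda>x. - v x) = (\<lambda>x. - act w v x)"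
  using act_lin[of w "-1" v 0 "\<lambda>x. 0"] by simp

lemma reflect_outside [simp]: "x \<noteq> s \<Longrightarrow> reflect s v x = v x"
  by (simp add: reflect_def)

lemma act_outside: "x \<notin> set w \<Longrightarrow> act w v x = v x"
  by (induction w) auto

end

locale finite_coxeter_system = coxeter_system +
  assumes finite_carrier: "finite (carrier W)"
begin

lemma finite_S [simp]: "finite S"
  using S_subset finite_carrier finite_subset by blast

lemma ord_pos: "s \<in> S \<Longrightarrow> t \<in> S \<Longrightarrow> 0 < ord (s \<otimes> t)"
  using ord_ge_1[OF finite_carrier, of "s \<otimes> t"] by simp

lemma ord_ge_2: "s \<in> S \<Longrightarrow> t \<in> S \<Longrightarrow> s \<noteq> t \<Longrightarrow> 2 \<le> ord (s \<otimes> t)"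
  using ord_pos[of s t] ord_neq_one[of s t] by linarith

lemma pair_alpha [simp]: "t \<in> S \<Longrightarrow> pair s (alpha t) = bil s t"
  by (simp add: pair_def alpha_def if_distrib cong: if_cong)

lemma pair_reflect: "s \<in> S \<Longrightarrow> pair s (reflect s v) = - pair s v"
proof -
  assume s: "s \<in> S"
  have "reflect s v = (\<lambda>x. 1 * v x + (- 2 * pair s v) * alpha s x)"
    by (auto simp: reflect_def alpha_def)
  then have "pair s (reflect s v) = 1 * pair s v + (- 2 * pair s v) * pair s (alpha s)"
    by (metis pair_lin)
  then show ?thesis using s by simp
qed

lemma reflect_reflect [simp]: "s \<in> S \<Longrightarrow> reflect s (reflect s v) = v"
  by (rule ext) (simp add: reflect_def pair_reflect[unfolded reflect_def])

lemma act_rev_act [simp]: "set w \<subseteq> S \<Longrightarrow> act (rev w) (act w v) = v"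
  by (induction w arbitrary: v) auto

lemma act_act_rev [simp]: "set w \<subseteq> S \<Longrightarrow> act w (act (rev w) v) = v"
  using act_rev_act[of "rev w" v] by simp

lemma reflect_alpha: "s \<in> S \<Longrightarrow> reflect s (alpha s) = (\<lambda>x. - alpha s x)"
proof -
  assume "s \<in> S"
  then have "pair s (alpha s) = 1" by simp
  then show ?thesis by (simp add: reflect_def fun_eq_iff) (simp add: alpha_def)
qed

lemma reflect_alpha_commute:
  "s \<in> S \<Longrightarrow> t \<in> S \<Longrightarrow> s \<noteq> t \<Longrightarrow> s \<otimes> t = t \<otimes> s \<Longrightarrow> reflect s (alpha t) = alpha t"
  by (simp add: reflect_def bil_commute_eq_0)

lemma act_alpha_nonzero: "set w \<subseteq> S \<Longrightarrow> act w (alpha s) \<noteq> (\<lambda>x. 0)"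
proof
  assume "set w \<subseteq> S" "act w (alpha s) = (\<lambda>x. 0)"
  then have "alpha s = (\<lambda>x. 0)" using act_rev_act[of w "alpha s"] by simp
  then show False by (metis alpha_def zero_neq_one)
qed

section \<open>Dihedral subgroups and the plane of two simple roots\<close>

definition comb :: "'a \<Rightarrow> 'a \<Rightarrow> real \<Rightarrow> real \<Rightarrow> 'a \<Rightarrow> real" where
  "comb s t p q = (\<lambda>x. p * alpha s x + q * alpha t x)"

lemma act_comb: "act w (comb s t p q) = (\<lambda>x. p * act w (alpha s) x + q * act w (alpha t) x)"
  unfolding comb_def by (rule act_lin)

lemma reflect_comb:
  assumes "s \<in> S" "t \<in> S" "s \<noteq> t"
  shows "reflect s (comb s t p q) = comb s t (- p - 2 * bil s t * q) q"
    and "reflect t (comb s t p q) = comb s t p (- q - 2 * bil s t * p)"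
proof -
  have "pair s (comb s t p q) = p + q * bil s t" "pair t (comb s t p q) = p * bil s t + q"
    using assms bil_comm[of t s] by (simp_all add: comb_def pair_lin)
  then show "reflect s (comb s t p q) = comb s t (- p - 2 * bil s t * q) q"
    and "reflect t (comb s t p q) = comb s t p (- q - 2 * bil s t * p)"
    using assms by (auto simp: reflect_def) (auto simp: comb_def alpha_def)
qed

text \<open>
  On the plane of \<open>s\<close> and \<open>t\<close>, each further letter of the alternating word replaces the older of the
  two coordinates by the next term of a linear recurrence.
\<close>

lemma act_alt_comb:
  assumes "s \<in> S" "t \<in> S" "s \<noteq> t"
    and rec: "\<And>j. f (Suc (Suc j)) = - f j - 2 * bil s t * f (Suc j)"
  shows "act (alt k s t) (comb s t (f 1) (f 0)) =
    (if even k then comb s t (f (Suc k)) (f k) else comb s t (f k) (f (Suc k)))"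
proof (induction k)
  case (Suc k)
  then show ?case
    by (simp add: reflect_comb[OF assms(1-3)] rec)
qed simp

lemma sin_angle_pos:
  assumes "s \<in> S" "t \<in> S" "s \<noteq> t"
  shows "0 < sin (pi / real (ord (s \<otimes> t)))"
proof -
  have "2 \<le> ord (s \<otimes> t)" by (rule ord_ge_2[OF assms])
  then show ?thesis by (intro sin_gt_zero) (auto simp: divide_simps)
qed

text \<open>Combinations of \<open>sin (j * \<theta>)\<close> and \<open>cos (j * \<theta>)\<close>
  solve the recurrence of \<open>act_alt_comb\<close>. They have period \<open>2 * m\<close> in
  \<open>j\<close>, so the full relator brings back the initial coordinates.\<close>

lemma act_relation_comb:
  assumes "s \<in> S" "t \<in> S" "s \<noteq> t"
  shows "act (alt (2 * ord (s \<otimes> t)) s t) (comb s t p q) = comb s t p q"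
proof -
  define m where "m = ord (s \<otimes> t)"
  define \<theta> where "\<theta> = pi / real m"
  have sin0: "sin \<theta> > 0" using sin_angle_pos[OF assms] by (simp add: \<theta>_def m_def)
  have m0: "m > 0" using ord_pos assms by (simp add: m_def)
  have bil: "bil s t = - cos \<theta>" by (simp add: bil_def \<theta>_def m_def)
  \<comment> \<open>Chosen so that \<open>f 1 = p\<close>; the cosine coefficient already gives
    \<open>f 0 = q\<close>.\<close>
  define A where "A = (p - q * cos \<theta>) / sin \<theta>"
  define f where "f j = A * sin (real j * \<theta>) + q * cos (real j * \<theta>)" for j :: nat
  have rec: "f (Suc (Suc j)) = - f j - 2 * bil s t * f (Suc j)" for j
  proof -
    have *: "real (Suc (Suc j)) * \<theta> = real j * \<theta> + 2 * \<theta>" "real (Suc j) * \<theta> = real j * \<theta> + \<theta>"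
      by (simp_all add: algebra_simps)
    show ?thesis unfolding f_def bil * sin_cos_step by (simp add: algebra_simps)
  qed
  have f01: "f 1 = p" "f 0 = q" using sin0 by (simp_all add: f_def A_def)
  have per: "f (j + 2 * m) = f j" for j
  proof -
    have "real (j + 2 * m) * \<theta> = real j * \<theta> + 2 * pi"
      using m0 by (simp add: \<theta>_def field_simps)
    then show ?thesis by (simp add: f_def)
  qed
  show ?thesis
    using act_alt_comb[OF assms, of f "2 * m"] rec per[of 0] per[of 1] f01
    by (simp add: m_def)
qed

lemma act_fixed: "(\<And>s. s \<in> set w \<Longrightarrow> pair s v = 0) \<Longrightarrow> act w v = v"
  by (induction w) (auto simp: reflect_def)

text \<open>For distinct \<open>s\<close> and \<open>t\<close> the form is nondegenerate on their
  plane, its Gram determinant being the square of a nonzero sine. So \<open>v\<close> is a vector of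
  the plane, settled by \<open>act_relation_comb\<close>, plus a vector orthogonal to both roots,
  fixed by every letter.\<close>

lemma act_relation:
  assumes "s \<in> S" "t \<in> S"
  shows "act (concat (replicate (ord (s \<otimes> t)) [s, t])) v = v"
proof (cases "s = t")
  case True
  then show ?thesis using assms by (simp add: numeral_eq_Suc)
next
  case False
  define C where "C = bil s t"
  define d where "d = 1 - C * C"
  have "d = (sin (pi / real (ord (s \<otimes> t))))\<^sup>2"
    unfolding sin_squared_eq by (simp add: d_def C_def bil_def power2_eq_square)
  then have d: "d \<noteq> 0" using sin_angle_pos[OF assms False] by simp
  \<comment> \<open>Cramer's rule for the component of \<open>v\<close> in the plane.\<close>
  define p where "p = (pair s v - C * pair t v) / d"
  define q where "q = (pair t v - C * pair s v) / d"
  define z where "z = (\<lambda>x. 1 * v x + (- 1) * comb s t p q x)"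
  have "p + q * C = pair s v * (1 - C * C) / d" "p * C + q = pair t v * (1 - C * C) / d"
    by (simp_all add: p_def q_def field_simps add_divide_distrib[symmetric] diff_divide_distrib[symmetric])
  then have pq: "p + q * C = pair s v" "p * C + q = pair t v"
    using d by (simp_all add: d_def)
  have "pair s (comb s t p q) = p + q * C" "pair t (comb s t p q) = p * C + q"
    using assms bil_comm[of t s] by (simp_all add: comb_def pair_lin C_def)
  then have z: "pair s z = 0" "pair t z = 0"
    unfolding z_def pair_lin using pq by simp_all
  have v: "v = (\<lambda>x. 1 * z x + 1 * comb s t p q x)" by (simp add: z_def)
  let ?r = "alt (2 * ord (s \<otimes> t)) s t"
  have "act ?r z = z"
    using z set_alt[of _ s t] by (intro act_fixed) blast
  then have "act ?r v = v"
    by (subst (1 2) v) (simp only: act_lin act_relation_comb[OF assms False])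
  then show ?thesis by (simp add: concat_replicate_eq_alt)
qed

lemma coxeter_step_act: "coxeter_step W S u u' \<Longrightarrow> act u = act u'"
  by (induction rule: coxeter_step.induct) (auto simp: act_relation)

text \<open>Each defining relation acts trivially, so by the presentation the action factors through
  \<open>W\<close>.\<close>

lemma act_cong:
  assumes "set u \<subseteq> S" "set u' \<subseteq> S" "wprod u = wprod u'"
  shows "act u = act u'"
proof -
  have "equivclp (coxeter_step W S) u u'"
    using presentation[of u u'] assms by (auto simp: in_lists_conv_set)
  then show ?thesis
    by (induction rule: equivclp_induct) (auto dest: coxeter_step_act)
qed

lemma wprod_alt_relation:
  assumes "s \<in> S" "t \<in> S"
  shows "wprod (alt (2 * ord (s \<otimes> t)) s t) = \<one>"
proof -
  have "wprod (concat (replicate m [s, t])) = (s \<otimes> t) [^] m \<and> set (concat (replicate m [s, t])) \<subseteq> S"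
    for m :: nat
  proof (induction m)
    case (Suc m)
    then show ?case
      using assms nat_pow_mult[of "s \<otimes> t" 1 m] by (simp add: m_assoc del: nat_pow_Suc)
  qed simp
  then show ?thesis
    using assms by (metis S_carrier concat_replicate_eq_alt m_closed pow_ord_eq_1)
qed

text \<open>The relator of length \<open>2 * m\<close> splits into \<open>m - 1\<close> and
  \<open>m + 1\<close> letters. Its second part, which also ends the given word, has the same
  product as the reversed first part, two letters shorter.\<close>

lemma alt_shorten:
  assumes "s \<in> S" "t \<in> S" "ord (s \<otimes> t) < j"
  shows "\<exists>u. set u \<subseteq> S \<and> length u + 2 \<le> j \<and> wprod u = wprod (alt j s t)"
proof -
  define m where "m = ord (s \<otimes> t)"
  define i where "i = m - 1"
  have m: "m > 0" using assms ord_pos m_def by simp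
  have m2: "2 * m = i + (m + 1)" using m by (simp add: i_def)
  let ?r = "alt (2 * m) s t"
  have sub: "set (alt k s t) \<subseteq> S" for k using set_alt[of k s t] assms by blast
  define a where "a = take i ?r"
  have r: "?r = a @ alt (m + 1) s t"
    using drop_alt[of i "m + 1" s t] append_take_drop_id[of i ?r] by (simp only: m2 a_def)
  have a: "set a \<subseteq> S" "length a = i"
    unfolding a_def using sub[of "2 * m"] set_take_subset[of i ?r] m2 by (blast, simp)
  have "wprod a \<otimes> wprod (alt (m + 1) s t) = \<one>"
    using wprod_alt_relation[OF assms(1,2)] r a sub wprod_append by (metis m_def)
  then have inv: "wprod (alt (m + 1) s t) = wprod (rev a)"
    using a sub by (metis inv_equality inv_inv wprod_closed wprod_rev)
  obtain k where k: "j = k + (m + 1)" using assms(3) by (metis Suc_eq_plus1 Suc_leI le_iff_add add.commute m_def)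
  define b where "b = take k (alt j s t)"
  have j: "alt j s t = b @ alt (m + 1) s t"
    using drop_alt[of k "m + 1" s t] append_take_drop_id[of k "alt j s t"] by (simp only: k b_def)
  have b: "set b \<subseteq> S" "length b = k"
    using sub[of j] set_take_subset[of k "alt j s t"] k by (auto simp: b_def)
  have "wprod (b @ rev a) = wprod (alt j s t)"
    using a b sub[of "m + 1"] inv by (simp add: j del: alt.simps Suc_eq_plus1 add_Suc_right)
  moreover have "length (b @ rev a) + 2 \<le> j" using a b k m by (simp add: i_def)
  ultimately show ?thesis using a b by (intro exI[of _ "b @ rev a"]) auto
qed

text \<open>The coordinates are \<open>sin (k * \<theta>) / sin \<theta>\<close> and
  \<open>sin ((k + 1) * \<theta>) / sin \<theta>\<close>, whose angles do not exceed
  \<open>pi\<close> as long as \<open>k + 1\<close> is at most the order.\<close>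

lemma act_alt_alpha:
  assumes "s \<in> S" "t \<in> S" "s \<noteq> t" "k < ord (s \<otimes> t)"
  shows "\<exists>p q. 0 \<le> p \<and> 0 \<le> q \<and> act (alt k s t) (alpha s) = comb s t p q"
proof -
  define m where "m = ord (s \<otimes> t)"
  define \<theta> where "\<theta> = pi / real m"
  have sin0: "sin \<theta> > 0" using sin_angle_pos[OF assms(1-3)] by (simp add: \<theta>_def m_def)
  have bil: "bil s t = - cos \<theta>" by (simp add: bil_def \<theta>_def m_def)
  define f where "f j = sin (real j * \<theta>) / sin \<theta>" for j :: nat
  have rec: "f (Suc (Suc j)) = - f j - 2 * bil s t * f (Suc j)" for j
  proof -
    have *: "real (Suc (Suc j)) * \<theta> = real j * \<theta> + 2 * \<theta>" "real (Suc j) * \<theta> = real j * \<theta> + \<theta>"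
      by (simp_all add: algebra_simps)
    show ?thesis unfolding f_def bil * sin_cos_step by (simp add: diff_divide_distrib)
  qed
  have f01: "f 1 = 1" "f 0 = 0" using sin0 by (simp_all add: f_def)
  have nonneg: "0 \<le> f j" if "j \<le> m" for j
  proof -
    have "real j * \<theta> \<le> pi" using that assms(4) by (simp add: \<theta>_def m_def field_simps)
    moreover have "0 \<le> real j * \<theta>" by (simp add: \<theta>_def)
    ultimately show ?thesis unfolding f_def using sin0 by (simp add: sin_ge_zero)
  qed
  have "alpha s = comb s t 1 0" by (simp add: comb_def)
  then have "act (alt k s t) (alpha s) =
      (if even k then comb s t (f (Suc k)) (f k) else comb s t (f k) (f (Suc k)))"
    using act_alt_comb[OF assms(1-3), of f k] rec f01 by simp
  moreover have "0 \<le> f k" "0 \<le> f (Suc k)" using nonneg assms(4) by (auto simp: m_def)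
  ultimately show ?thesis by metis
qed

end

section \<open>Roots and the longest element\<close>

context finite_coxeter_system
begin

text \<open>
  Split off from \<open>u\<close> an alternating suffix in \<open>s\<close> and \<open>t\<close> of maximal length. Neither \<open>s\<close> nor \<open>t\<close> is
  a descent of the rest, which reduces the claim to the dihedral group of \<open>s\<close> and \<open>t\<close>.
\<close>

lemma act_alpha_pos:
  assumes "set u \<subseteq> S" "s \<in> S" "len (wprod u) < len (wprod u \<otimes> s)"
  shows "pos (act u (alpha s))"
  using assms
proof (induction "len (wprod u)" arbitrary: u s rule: less_induct)
  case less
  note u = less.prems(1) and s = less.prems(2) and up = less.prems(3)
  show ?case
  proof (cases "len (wprod u) = 0")
    case True
    then have "wprod u = wprod []" using u len_0_iff by simp
    then have "act u = act []" using u by (intro act_cong) auto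
    then show ?thesis by (simp add: pos_def alpha_def)
  next
    case False
    obtain u' where u': "set u' \<subseteq> S" "wprod u' = wprod u" "length u' = len (wprod u)"
      using ex_reduced[of "wprod u"] u by auto
    with False obtain b t where bt: "u' = b @ [t]" by (cases u' rule: rev_cases) auto
    have t: "t \<in> S" using u' bt by simp
    have st: "s \<noteq> t"
    proof
      assume "s = t"
      then have "wprod u \<otimes> s = wprod b"
        using u' bt t by (simp flip: u'(2) add: m_assoc)
      then show False using up u' bt len_le[of b] by simp
    qed
    have sub: "set (alt k s t) \<subseteq> S" for k using set_alt[of k s t] s t by blast
    \<comment> \<open>The length condition makes \<open>v @ alt k s t\<close> a reduced word; the
      last letter of \<open>u'\<close> provides \<open>k = 1\<close>.\<close>
    define K where "K = {k. \<exists>v. set v \<subseteq> S \<and> length v + k = len (wprod u) \<and>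
      wprod u = wprod (v @ alt k s t)}"
    have K: "finite K" "1 \<in> K"
    proof -
      have "K \<subseteq> {..len (wprod u)}" by (auto simp: K_def)
      then show "finite K" using finite_subset by blast
      have "set b \<subseteq> S \<and> length b + 1 = len (wprod u) \<and> wprod u = wprod (b @ alt 1 s t)"
        using u' bt by (simp flip: u'(2))
      then show "1 \<in> K" unfolding K_def by blast
    qed
    define k where "k = Max K"
    have le_k: "j \<le> k" if "j \<in> K" for j using K(1) that by (simp add: k_def)
    have "k \<in> K" unfolding k_def using K by (intro Max_in) auto
    then have k: "k \<in> K" "1 \<le> k" "Suc k \<notin> K"
      using K(2) le_k[of 1] le_k[of "Suc k"] by auto
    then obtain v where v: "set v \<subseteq> S" "length v + k = len (wprod u)"
      "wprod u = wprod v \<otimes> wprod (alt k s t)"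
      using sub by (auto simp: K_def)
    have lv: "len (wprod v) = length v"
      using len_mult_le[of "wprod v" "wprod (alt k s t)"] len_le[OF v(1)] len_le[OF sub, of k] v sub
      by simp
    \<comment> \<open>Otherwise appending \<open>s\<close> makes the alternating suffix longer than
      the order, and \<open>alt_shorten\<close> contradicts \<open>up\<close>.\<close>
    have km: "k < ord (s \<otimes> t)"
    proof (rule ccontr)
      assume "\<not> k < ord (s \<otimes> t)"
      then have "ord (t \<otimes> s) < Suc k" using ord_prod_comm[OF s t] by simp
      then obtain a where a: "set a \<subseteq> S" "length a + 2 \<le> Suc k" "wprod a = wprod (alt (Suc k) t s)"
        using alt_shorten[OF t s] by blast
      have "wprod u \<otimes> s = wprod v \<otimes> wprod (alt k s t @ [s])"
        using v s sub[of k] by (simp add: m_assoc)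
      also have "\<dots> = wprod (v @ a)" using a v by (simp only: alt_snoc) simp
      finally have "len (wprod u \<otimes> s) \<le> length v + length a"
        using len_le[of "v @ a"] a v by simp
      then show False using up a v by simp
    qed
    \<comment> \<open>\<open>x\<close> would extend the alternating suffix to the left, and
      \<open>y\<close> is its first letter.\<close>
    define x where "x = (if even k then t else s)"
    define y where "y = (if even k then s else t)"
    have xy: "x \<in> S" "y \<in> S" using s t by (auto simp: x_def y_def)
    obtain k' where k': "k = Suc k'" using k(2) by (cases k) auto
    have altk: "alt (Suc k) s t = x # alt k s t" "alt k s t = y # alt k' s t"
      by (auto simp: x_def y_def k')
    \<comment> \<open>If \<open>x\<close> were a descent of \<open>v\<close>, it could be moved into
      the suffix, against maximality of \<open>k\<close>.\<close>
    have upx: "len (wprod v) < len (wprod v \<otimes> x)"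
    proof (rule ccontr)
      assume "\<not> ?thesis"
      then have l: "len (wprod v) = Suc (len (wprod v \<otimes> x))"
        using len_mult_S[of "wprod v" x] v xy by auto
      obtain v' where v': "set v' \<subseteq> S" "wprod v' = wprod v \<otimes> x" "length v' = len (wprod v \<otimes> x)"
        using ex_reduced[of "wprod v \<otimes> x"] v xy by auto
      have "wprod (v' @ alt (Suc k) s t) = wprod v \<otimes> x \<otimes> (x \<otimes> wprod (alt k s t))"
        using v' sub[of k] sub[of "Suc k"] altk by (simp del: alt.simps)
      also have "\<dots> = wprod u" using v xy sub[of k] by (simp add: m_assoc)
      finally have "Suc k \<in> K" using v' v lv l by (auto simp: K_def simp del: alt.simps intro!: exI[of _ v'])
      then show False using k by simp
    qed
    \<comment> \<open>If \<open>y\<close> were a descent of \<open>v\<close>, it would cancel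
      against the start of the suffix and shorten a reduced word.\<close>
    have upy: "len (wprod v) < len (wprod v \<otimes> y)"
    proof (rule ccontr)
      assume "\<not> ?thesis"
      then have l: "len (wprod v) = Suc (len (wprod v \<otimes> y))"
        using len_mult_S[of "wprod v" y] v xy by auto
      have "wprod u = (wprod v \<otimes> y) \<otimes> wprod (alt k' s t)"
        using v xy sub[of k'] altk by (simp add: m_assoc)
      then have "len (wprod u) \<le> len (wprod v \<otimes> y) + k'"
        using len_mult_le[of "wprod v \<otimes> y" "wprod (alt k' s t)"] len_le[OF sub, of k'] v xy sub by simp
      then show False using l lv v k' by simp
    qed
    have up2: "len (wprod v) < len (wprod v \<otimes> s)" "len (wprod v) < len (wprod v \<otimes> t)"
      using upx upy by (auto simp: x_def y_def split: if_splits)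
    have "len (wprod v) < len (wprod u)" using lv v k by simp
    then have ps: "pos (act v (alpha s))" and pt: "pos (act v (alpha t))"
      using less.hyps v(1) s t up2 by auto
    obtain p q where pq: "0 \<le> p" "0 \<le> q" "act (alt k s t) (alpha s) = comb s t p q"
      using act_alt_alpha[OF s t st km] by blast
    have "act u = act (v @ alt k s t)" using u v sub[of k] by (intro act_cong) auto
    then have "act u (alpha s) = (\<lambda>x. p * act v (alpha s) x + q * act v (alpha t) x)"
      using pq act_comb by simp
    then show ?thesis using ps pt pq by (simp add: pos_def)
  qed
qed

lemma act_alpha_neg:
  assumes "set u \<subseteq> S" "s \<in> S" "len (wprod u \<otimes> s) < len (wprod u)"
  shows "neg (act u (alpha s))"
proof -
  have "pos (act (u @ [s]) (alpha s))"
    using assms by (intro act_alpha_pos) (auto simp: m_assoc)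
  then show ?thesis using assms(2) by (simp add: reflect_alpha act_uminus pos_def neg_def)
qed

lemma not_pos_and_neg: "set u \<subseteq> S \<Longrightarrow> pos (act u (alpha s)) \<Longrightarrow> \<not> neg (act u (alpha s))"
  using act_alpha_nonzero[of u s] by (auto simp: pos_def neg_def fun_eq_iff intro: antisym)

lemma act_alpha_pos_iff:
  assumes "set u \<subseteq> S" "s \<in> S"
  shows "pos (act u (alpha s)) \<longleftrightarrow> len (wprod u) < len (wprod u \<otimes> s)"
  using act_alpha_pos[OF assms] act_alpha_neg[OF assms] not_pos_and_neg[OF assms(1)]
    len_mult_S[of "wprod u" s] assms by fastforce

lemma act_alpha_neg_iff:
  assumes "set u \<subseteq> S" "s \<in> S"
  shows "neg (act u (alpha s)) \<longleftrightarrow> len (wprod u \<otimes> s) < len (wprod u)"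
  using act_alpha_pos[OF assms] act_alpha_neg[OF assms] not_pos_and_neg[OF assms(1)]
    len_mult_S[of "wprod u" s] assms by fastforce

lemma pos_or_neg: "set u \<subseteq> S \<Longrightarrow> s \<in> S \<Longrightarrow> pos (act u (alpha s)) \<or> neg (act u (alpha s))"
  using act_alpha_pos act_alpha_neg len_mult_S[of "wprod u" s] by fastforce

lemma act_sum:
  assumes "finite F"
  shows "act u (\<lambda>x. \<Sum>s\<in>F. a s * alpha s x) = (\<lambda>x. \<Sum>s\<in>F. a s * act u (alpha s) x)"
  using assms
proof (induction F rule: finite_induct)
  case (insert s F)
  then show ?case
    using act_lin[of u "a s" "alpha s" 1 "\<lambda>x. \<Sum>s\<in>F. a s * alpha s x"] by simp
qed simp

lemma act_alpha_support:
  assumes "set u \<subseteq> S" "s \<in> S" "x \<notin> S"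
  shows "act u (alpha s) x = 0"
proof -
  have "x \<notin> set u" "x \<noteq> s" using assms by auto
  then show ?thesis by (simp add: act_outside) (simp add: alpha_def)
qed

lemma expand_alpha:
  assumes "\<And>x. x \<notin> S \<Longrightarrow> v x = 0"
  shows "v = (\<lambda>x. \<Sum>s\<in>S. v s * alpha s x)"
  using assms by (auto simp: alpha_def fun_eq_iff if_distrib cong: if_cong)

section \<open>The longest element and conjugation by it\<close>

context
  fixes w0
  assumes w0: "longest_element W S w0"
begin

lemma w0_carrier [simp]: "w0 \<in> carrier W"
  using w0 by (simp add: longest_element_def)

lemma len_le_w0: "w \<in> carrier W \<Longrightarrow> len w \<le> len w0"
  using w0 by (simp add: longest_element_def)

text \<open>By maximality \<open>inv w0\<close> makes every simple root negative, hence also every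
  nonnegative combination of them, such as the root that \<open>g\<close> makes of
  \<open>alpha s\<close>.\<close>

lemma w0_inv_down:
  assumes g: "g \<in> carrier W" and s: "s \<in> S" and up: "len g < len (g \<otimes> s)"
  shows "len (inv w0 \<otimes> g \<otimes> s) < len (inv w0 \<otimes> g)"
proof -
  obtain a b where a: "set a \<subseteq> S" "wprod a = inv w0" and b: "set b \<subseteq> S" "wprod b = g"
    using ex_word g inv_closed[OF w0_carrier] by metis
  have neg_a: "neg (act a (alpha t))" if t: "t \<in> S" for t
  proof -
    have "len (inv w0 \<otimes> t) \<le> len (inv w0)" using len_le_w0 len_inv t by simp
    then have "len (inv w0 \<otimes> t) < len (inv w0)" using len_mult_S[of "inv w0" t] t by auto
    then show ?thesis using act_alpha_neg[OF a(1) t] a by simp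
  qed
  define v where "v = act b (alpha s)"
  have v: "pos v" using act_alpha_pos[OF b(1) s] b up by (simp add: v_def)
  have "v = (\<lambda>x. \<Sum>t\<in>S. v t * alpha t x)"
    using act_alpha_support[OF b(1) s] by (intro expand_alpha) (simp add: v_def)
  then have "act a v = (\<lambda>x. \<Sum>t\<in>S. v t * act a (alpha t) x)" using act_sum[OF finite_S] by metis
  then have "neg (act (a @ b) (alpha s))"
    using v neg_a by (auto simp: v_def[symmetric] neg_def pos_def intro!: sum_nonpos mult_nonneg_nonpos)
  then show ?thesis using act_alpha_neg_iff[of "a @ b" s] a b s by simp
qed

text \<open>Along a reduced word of \<open>g\<close>, each letter lengthens the prefix by one and,
  by \<open>w0_inv_down\<close>, shortens its product with \<open>inv w0\<close> by one.\<close>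

lemma len_w0_inv_mult:
  assumes "g \<in> carrier W"
  shows "len (inv w0 \<otimes> g) + len g = len w0"
  using assms
proof (induction "len g" arbitrary: g)
  case 0
  then show ?case using len_0_iff[of g] len_inv[of w0] by simp
next
  case (Suc n)
  obtain u where u: "set u \<subseteq> S" "wprod u = g" "length u = Suc n"
    using ex_reduced[OF Suc.prems] Suc.hyps by auto
  then obtain b t where bt: "u = b @ [t]" by (cases u rule: rev_cases) auto
  have t: "t \<in> S" and b: "set b \<subseteq> S" using u bt by auto
  have g: "g = wprod b \<otimes> t" using u bt by auto
  have len_b: "len (wprod b) = n"
    using len_le[OF b] u bt Suc.hyps(2) len_mult_S[of "wprod b" t] b t g by auto
  have "len (inv w0 \<otimes> wprod b \<otimes> t) < len (inv w0 \<otimes> wprod b)"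
    using w0_inv_down[of "wprod b" t] b t g Suc.hyps(2) len_b by auto
  then have "len (inv w0 \<otimes> wprod b) = Suc (len (inv w0 \<otimes> g))"
    using len_mult_S[of "inv w0 \<otimes> wprod b" t] b t g by (auto simp: m_assoc)
  moreover have "len (inv w0 \<otimes> wprod b) + len (wprod b) = len w0"
    using Suc.hyps(1)[of "wprod b"] len_b b by simp
  ultimately show ?case using len_b Suc.hyps(2) by simp
qed

lemma len_inv_mult_w0: "g \<in> carrier W \<Longrightarrow> len (inv g \<otimes> w0) + len g = len w0"
  using len_w0_inv_mult[of g] len_inv[of "inv w0 \<otimes> g"] by (simp add: inv_mult_group)

text \<open>As \<open>inv w0\<close> is as long as \<open>w0\<close>, its complement
  \<open>w0 \<otimes> w0\<close> has length 0.\<close>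

lemma w0_inv: "inv w0 = w0"
proof -
  have "len (inv (inv w0) \<otimes> w0) = 0"
    using len_inv_mult_w0[of "inv w0"] len_inv[of w0] by simp
  then have "w0 \<otimes> w0 = \<one>" using len_0_iff by simp
  then show ?thesis using inv_equality by simp
qed

text \<open>Taking complements in \<open>w0\<close> twice, on either side, returns the length 1 of
  \<open>s\<close>.\<close>

lemma psi_S:
  assumes "s \<in> S"
  shows "psi W w0 s \<in> S"
proof (rule ex_S_of_len_1)
  have "len s \<noteq> 0" "len s \<le> 1"
    using len_0_iff[of s] S_not_one[OF assms] len_le[of "[s]"] assms by auto
  then have "len s = 1" by simp
  then have "len (s \<otimes> w0) + 1 = len w0"
    using len_inv_mult_w0[of s] assms by simp
  moreover have "len (inv w0 \<otimes> (s \<otimes> w0)) + len (s \<otimes> w0) = len w0"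
    using len_w0_inv_mult[of "s \<otimes> w0"] assms by simp
  ultimately show "len (psi W w0 s) = 1" using assms by (simp add: psi_def m_assoc)
qed (use assms in \<open>simp add: psi_def\<close>)

lemma psi_psi:
  assumes "x \<in> carrier W"
  shows "psi W w0 (psi W w0 x) = x"
proof -
  have sq: "w0 \<otimes> w0 = \<one>" using w0_inv r_inv[of w0] by simp
  then have "w0 \<otimes> (w0 \<otimes> x) = x" using m_assoc[of w0 w0 x] assms by simp
  then show ?thesis using assms sq by (simp add: psi_def w0_inv m_assoc)
qed

lemma psi_mult:
  assumes "x \<in> carrier W" "y \<in> carrier W"
  shows "psi W w0 (x \<otimes> y) = psi W w0 x \<otimes> psi W w0 y"
proof -
  have "w0 \<otimes> (inv w0 \<otimes> (y \<otimes> w0)) = y \<otimes> w0"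
    using assms m_assoc[of w0 "inv w0" "y \<otimes> w0"] by simp
  then show ?thesis using assms by (simp add: psi_def m_assoc)
qed

lemma wprod_map_psi: "set u \<subseteq> S \<Longrightarrow> wprod (map (psi W w0) u) = psi W w0 (wprod u)"
  by (induction u) (simp_all add: psi_mult, simp add: psi_def)

end

declare w0_carrier [simp del]

end

section \<open>The order of letters in a Coxeter element\<close>

text \<open>Recursive form of the index condition in \<open>comes_before\<close>, suited to
  induction on words.\<close>

fun prec :: "'a list \<Rightarrow> 'a \<Rightarrow> 'a \<Rightarrow> bool" where
  "prec [] a b \<longleftrightarrow> False"
| "prec (x # xs) a b \<longleftrightarrow> x = a \<and> b \<in> set xs \<or> prec xs a b"

lemma prec_append:
  "prec (p @ q) a b \<longleftrightarrow> prec p a b \<or> prec q a b \<or> a \<in> set p \<and> b \<in> set q"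
  by (induction p) auto

lemma prec_set: "prec xs a b \<Longrightarrow> a \<in> set xs \<and> b \<in> set xs"
  by (induction xs) auto

lemma prec_map: "prec xs a b \<Longrightarrow> prec (map f xs) (f a) (f b)"
  by (induction xs) auto

lemma prec_iff_nth:
  "prec xs a b \<longleftrightarrow> (\<exists>i j. i < j \<and> j < length xs \<and> xs ! i = a \<and> xs ! j = b)"
proof (induction xs)
  case (Cons x xs)
  show ?case (is "?l = ?r")
  proof
    assume ?l
    then consider "x = a" "b \<in> set xs" | "prec xs a b" by auto
    then show ?r
    proof cases
      case 1
      then obtain j where "j < length xs" "xs ! j = b" by (auto simp: in_set_conv_nth)
      then show ?thesis using 1 by (intro exI[of _ 0] exI[of _ "Suc j"]) simp
    next
      case 2
      then obtain i j where "i < j" "j < length xs" "xs ! i = a" "xs ! j = b" using Cons by auto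
      then show ?thesis by (intro exI[of _ "Suc i"] exI[of _ "Suc j"]) simp
    qed
  next
    assume ?r
    then obtain i j where "i < j" "j < length (x # xs)" "(x # xs) ! i = a" "(x # xs) ! j = b" by blast
    then show ?l using Cons by (cases i; cases j) auto
  qed
qed simp

context finite_coxeter_system
begin

lemma pos_if_coeff_pos: "set u \<subseteq> S \<Longrightarrow> s \<in> S \<Longrightarrow> 0 < act u (alpha s) x \<Longrightarrow> pos (act u (alpha s))"
  using pos_or_neg[of u s] by (auto simp: neg_def not_less[symmetric])

text \<open>The first letter of \<open>p\<close> acts first on \<open>alpha s\<close>, and no later
  letter touches its coordinate. That coordinate vanishes only if the letter commutes with
  \<open>s\<close>; then \<open>alpha s\<close> is fixed and the argument continues with the rest of
  \<open>p\<close>.\<close>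

lemma commute_if_act_rev_alpha:
  assumes "distinct p" "set p \<subseteq> S" "s \<in> S" "s \<notin> set p"
    and "\<And>x. x \<in> set p \<Longrightarrow> act (rev p) (alpha s) x = 0"
  shows "\<forall>x\<in>set p. s \<otimes> x = x \<otimes> s"
  using assms
proof (induction p)
  case (Cons x p)
  have x: "x \<in> S" "x \<noteq> s" "x \<notin> set p" using Cons.prems by auto
  have "act (rev p) (reflect x (alpha s)) x = 0" using Cons.prems(5)[of x] by simp
  then have "reflect x (alpha s) x = 0" using x by (simp add: act_outside)
  moreover have "alpha s x = 0" using x by (simp add: alpha_def)
  ultimately have bil0: "bil x s = 0" using Cons.prems by (simp add: reflect_def)
  then have comm: "x \<otimes> s = s \<otimes> x" using bil_neg[of x s] x Cons.prems by force
  then have "reflect x (alpha s) = alpha s" using reflect_alpha_commute x Cons.prems by simp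
  then have "\<forall>y\<in>set p. s \<otimes> y = y \<otimes> s"
    using Cons.prems by (intro Cons.IH) auto
  then show ?case using comm by simp
qed simp

text \<open>Both reversed words send \<open>alpha s\<close> to the same vector. At a letter of
  \<open>p\<close>, the first word gives a nonpositive coordinate and the second a nonnegative one,
  so it is 0.\<close>

lemma first_letter_commutes:
  assumes "distinct (s # xs)" "distinct (p @ s # q)" "set (s # xs) \<subseteq> S" "set (p @ s # q) \<subseteq> S"
    and "wprod (s # xs) = wprod (p @ s # q)"
  shows "\<forall>x\<in>set p. s \<otimes> x = x \<otimes> s"
proof (rule commute_if_act_rev_alpha)
  have one: "act u (alpha s) s = 1" if "s \<notin> set u" for u
    using that act_outside[of s u "alpha s"] by (simp add: alpha_def)
  \<comment> \<open>Words without \<open>s\<close> keep the coordinate 1 at \<open>s\<close>, which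
    decides the sign of the root.\<close>
  have pos1: "pos (act (rev xs) (alpha s))" "pos (act (rev p) (alpha s))"
    using assms one[of "rev xs"] one[of "rev p"] by (auto intro!: pos_if_coeff_pos[where x = s])
  have "wprod (rev (s # xs)) = wprod (rev (p @ s # q))"
    using assms wprod_rev by metis
  then have "act (rev (s # xs)) = act (rev (p @ s # q))"
    using assms by (intro act_cong) auto
  then have eq: "act (rev (s # xs)) (alpha s) x = act (rev (p @ s # q)) (alpha s) x" for x by simp
  show "act (rev p) (alpha s) x = 0" if x: "x \<in> set p" for x
  proof -
    have "x \<noteq> s" "x \<notin> set q" using assms x by auto
    then have "act (rev (p @ s # q)) (alpha s) x = act (rev p) (alpha s) x"
      by (simp add: act_outside)
    moreover have "act (rev (s # xs)) (alpha s) x = - act (rev xs) (alpha s) x"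
      using assms by (simp add: reflect_alpha act_uminus)
    ultimately show ?thesis using eq[of x] pos1 by (simp add: pos_def) (smt (verit))
  qed
qed (use assms in auto)

lemma commute_wprod:
  assumes "s \<in> S" "set p \<subseteq> S" "\<forall>x\<in>set p. s \<otimes> x = x \<otimes> s"
  shows "s \<otimes> wprod p = wprod p \<otimes> s"
  using assms
proof (induction p)
  case (Cons x p)
  have "s \<otimes> (x \<otimes> wprod p) = (s \<otimes> x) \<otimes> wprod p" using Cons.prems(1,2) by (simp add: m_assoc)
  also have "s \<otimes> x = x \<otimes> s" using Cons.prems by simp
  also have "x \<otimes> s \<otimes> wprod p = x \<otimes> (s \<otimes> wprod p)" using Cons.prems(1,2) by (simp add: m_assoc)
  also have "\<dots> = x \<otimes> wprod p \<otimes> s" using Cons by (simp add: m_assoc)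
  finally show ?case by simp
qed simp

text \<open>The first letter of \<open>xs\<close> commutes with everything before it in
  \<open>ys\<close>, so it can be cancelled from both words. A letter not commuting with it must
  come after it in \<open>ys\<close>.\<close>

lemma prec_wprod_cong:
  assumes "distinct xs" "distinct ys" "set xs = set ys" "set xs \<subseteq> S" "wprod xs = wprod ys"
    and "prec xs a b" "a \<otimes> b \<noteq> b \<otimes> a"
  shows "prec ys a b"
  using assms(1-6)
proof (induction xs arbitrary: ys)
  case (Cons s xs)
  obtain p q where ys: "ys = p @ s # q"
    using Cons.prems(3) by (metis list.set_intros(1) split_list)
  have sub: "s \<in> S" "set p \<subseteq> S" "set q \<subseteq> S" "set xs \<subseteq> S" using Cons.prems ys by auto
  have comm: "\<forall>x\<in>set p. s \<otimes> x = x \<otimes> s"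
    using Cons.prems ys by (intro first_letter_commutes[of s xs p q]) auto
  have "s \<otimes> wprod xs = s \<otimes> (wprod p \<otimes> wprod q)"
    using Cons.prems(5) ys sub commute_wprod[OF sub(1,2) comm] by (simp add: m_assoc[symmetric])
  then have eq: "wprod xs = wprod (p @ q)" using sub by simp
  show ?case
  proof (cases "prec xs a b")
    case True
    have "prec (p @ q) a b"
    proof (rule Cons.IH)
      have "set (s # xs) - {s} = set ys - {s}" using Cons.prems(3) by simp
      then show "set xs = set (p @ q)" using Cons.prems(1,2) ys by auto
    qed (use Cons.prems ys eq True in auto)
    then show ?thesis by (auto simp: ys prec_append)
  next
    case False
    then have ab: "a = s" "b \<in> set xs" using Cons.prems by auto
    then have "b \<noteq> s" "b \<notin> set p" using comm assms(7) by auto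
    then have "b \<in> set q" using ab Cons.prems(3) ys by auto
    then show ?thesis using ab by (simp add: ys prec_append)
  qed
qed simp

text \<open>A word without \<open>s\<close> keeps every coordinate at \<open>s\<close>, whereas a
  word containing \<open>s\<close> once negates it on a suitable root. So \<open>cs\<close> contains
  all of \<open>S\<close>, and its length leaves no room for repetitions.\<close>

lemma reduced_word_of_coxeter_element:
  assumes "coxeter_element W S c" "reduced_word W S c cs"
  shows "distinct cs" "set cs = S"
proof -
  obtain xs where xs: "distinct xs" "set xs = S" "wprod xs = c"
    using assms(1) by (auto simp: coxeter_element_def)
  have cs: "set cs \<subseteq> S" "wprod cs = c" "length cs = len c"
    using assms(2) by (auto simp: reduced_word_iff reduced_def)
  have act: "act xs = act cs" using xs cs by (intro act_cong) auto
  have "s \<in> set cs" if s: "s \<in> S" for s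
  proof (rule ccontr)
    assume notin: "s \<notin> set cs"
    obtain u v where uv: "xs = u @ s # v" using s xs split_list by metis
    \<comment> \<open>Pulled back through \<open>v\<close>, so that the letter \<open>s\<close> of
      \<open>xs\<close> meets exactly \<open>alpha s\<close>.\<close>
    define y where "y = act (rev v) (alpha s)"
    have alpha1: "alpha s s = (1::real)" by (simp add: alpha_def)
    have sv: "set v \<subseteq> S" "s \<notin> set v" "s \<notin> set u" using uv xs by auto
    have "y s = 1" using sv alpha1 by (simp add: y_def act_outside)
    then have "act cs y s = 1" using notin by (simp add: act_outside)
    moreover have "act xs y s = -1"
      using uv sv s alpha1 by (simp add: y_def reflect_alpha act_uminus act_outside)
    ultimately show False using act by simp
  qed
  then show eq: "set cs = S" using cs by blast
  have "length cs \<le> length xs" using len_le[of xs] xs cs by simp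
  then have "length cs \<le> card (set cs)" using xs eq distinct_card[of xs] by simp
  then show "distinct cs" using card_length[of cs] by (intro card_distinct) simp
qed

lemma comes_before_iff_prec:
  assumes "coxeter_element W S c" "reduced_word W S c cs" "a \<otimes> b \<noteq> b \<otimes> a"
  shows "comes_before W S c a b \<longleftrightarrow> prec cs a b"
proof
  assume "comes_before W S c a b"
  then obtain us where us: "reduced_word W S c us" "prec us a b"
    by (auto simp: comes_before_def prec_iff_nth)
  show "prec cs a b"
    using reduced_word_of_coxeter_element[OF assms(1,2)] reduced_word_of_coxeter_element[OF assms(1) us(1)]
      assms us prec_wprod_cong[of us cs a b] by (simp add: reduced_word_iff)
next
  assume "prec cs a b"
  then show "comes_before W S c a b" using assms(2) by (auto simp: comes_before_def prec_iff_nth)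
qed

end

section \<open>Firing sequences and the skew form\<close>

context finite_coxeter_system
begin

text \<open>
  A state \<open>d\<close> orients the Coxeter graph by \<open>a \<rightarrow> b\<close> iff \<open>d a < d b\<close>, and \<open>omega d\<close> is the skew form
  of this orientation (Speyer's form of the corresponding Coxeter element).
\<close>

definition arrow :: "('a \<Rightarrow> nat) \<Rightarrow> 'a \<Rightarrow> 'a \<Rightarrow> real" where
  "arrow d a b = (if d a < d b then - bil a b else if d b < d a then bil a b else 0)"

definition omega :: "('a \<Rightarrow> nat) \<Rightarrow> ('a \<Rightarrow> real) \<Rightarrow> ('a \<Rightarrow> real) \<Rightarrow> real" where
  "omega d u v = (\<Sum>a\<in>S. \<Sum>b\<in>S. arrow d a b * u a * v b)"

lemma arrow_same [simp]: "arrow d a a = 0"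
  by (simp add: arrow_def)

lemma arrow_antisym: "a \<in> S \<Longrightarrow> b \<in> S \<Longrightarrow> arrow d b a = - arrow d a b"
  using bil_comm[of a b] by (simp add: arrow_def)

text \<open>Isolates the row and column of \<open>r\<close>: \<open>e = - 1\<close> when
  \<open>r\<close> is a source, \<open>e = 1\<close> when it is a sink.\<close>

lemma omega_split:
  assumes "r \<in> S" and "\<And>b. b \<in> S - {r} \<Longrightarrow> arrow d r b = e * bil r b"
  shows "omega d u v = (\<Sum>a\<in>S - {r}. \<Sum>b\<in>S - {r}. arrow d a b * u a * v b)
    + e * u r * (\<Sum>b\<in>S - {r}. bil r b * v b) - e * v r * (\<Sum>a\<in>S - {r}. bil r a * u a)"
proof -
  have split: "sum f S = f r + sum f (S - {r})" for f :: "'a \<Rightarrow> real"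
    using assms(1) by (simp add: sum.remove)
  have ar: "arrow d a r = - e * bil r a" if "a \<in> S - {r}" for a
    using assms arrow_antisym[of r a d] that by simp
  have "omega d u v = (\<Sum>b\<in>S. arrow d r b * u r * v b)
      + (\<Sum>a\<in>S - {r}. \<Sum>b\<in>S. arrow d a b * u a * v b)"
    unfolding omega_def by (rule split)
  also have "(\<Sum>b\<in>S. arrow d r b * u r * v b) = (\<Sum>b\<in>S - {r}. arrow d r b * u r * v b)"
    by (subst split) simp
  also have "\<dots> = e * u r * (\<Sum>b\<in>S - {r}. bil r b * v b)"
    unfolding sum_distrib_left by (rule sum.cong) (simp_all add: assms)
  also have "(\<Sum>a\<in>S - {r}. \<Sum>b\<in>S. arrow d a b * u a * v b) =
      (\<Sum>a\<in>S - {r}. arrow d a r * u a * v r + (\<Sum>b\<in>S - {r}. arrow d a b * u a * v b))"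
    by (subst split) simp
  also have "\<dots> = (\<Sum>a\<in>S - {r}. arrow d a r * u a * v r)
      + (\<Sum>a\<in>S - {r}. \<Sum>b\<in>S - {r}. arrow d a b * u a * v b)"
    by (rule sum.distrib)
  also have "(\<Sum>a\<in>S - {r}. arrow d a r * u a * v r) = - e * v r * (\<Sum>a\<in>S - {r}. bil r a * u a)"
    unfolding sum_distrib_left by (rule sum.cong) (simp_all add: ar)
  finally show ?thesis by simp
qed

lemma omega_alpha:
  assumes "a \<in> S" "b \<in> S"
  shows "omega d (alpha a) (alpha b) = arrow d a b"
proof -
  have "arrow d x y * alpha a x * alpha b y = (if x = a then if y = b then arrow d a b else 0 else 0)"
    for x y by (simp add: alpha_def)
  moreover have "(\<Sum>y\<in>S. if x = a then if y = b then arrow d a b else 0 else 0) =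
      (if x = a then arrow d a b else 0)" for x
    using assms by simp
  ultimately show ?thesis using assms by (simp add: omega_def)
qed

text \<open>The upper bound \<open>d b < d r + n\<close> ensures that raising \<open>d r\<close> by
  \<open>n\<close> turns the source \<open>r\<close> into a sink.\<close>

definition source :: "nat \<Rightarrow> ('a \<Rightarrow> nat) \<Rightarrow> 'a \<Rightarrow> bool" where
  "source n d r \<longleftrightarrow> r \<in> S \<and> (\<forall>b\<in>S. r \<otimes> b \<noteq> b \<otimes> r \<longrightarrow> d r < d b \<and> d b < d r + n)"

lemma arrow_source:
  assumes "source n d r" "b \<in> S - {r}"
  shows "arrow d r b = - 1 * bil r b" "arrow (d(r := d r + n)) r b = 1 * bil r b"
  using assms bil_commute_eq_0[of r b] by (auto simp: arrow_def source_def)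

text \<open>Firing flips the sign of the row and column of \<open>r\<close>. Reflecting changes only
  the coordinates at \<open>r\<close>, with the same effect: the extra products
  \<open>f u * f v\<close> cancel by skew symmetry.\<close>

lemma omega_fire:
  assumes "source n d r"
  shows "omega (d(r := d r + n)) u v = omega d (reflect r u) (reflect r v)"
proof -
  define d' where "d' = d(r := d r + n)"
  have r: "r \<in> S" using assms by (simp add: source_def)
  define f where "f v = (\<Sum>b\<in>S - {r}. bil r b * v b)" for v :: "'a \<Rightarrow> real"
  define C where "C u v = (\<Sum>a\<in>S - {r}. \<Sum>b\<in>S - {r}. arrow d a b * u a * v b)"
    for u v :: "'a \<Rightarrow> real"
  have C': "(\<Sum>a\<in>S - {r}. \<Sum>b\<in>S - {r}. arrow d' a b * u a * v b) = C u v" for u v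
    unfolding C_def by (intro sum.cong) (auto simp: d'_def arrow_def)
  have 1: "omega d u v = C u v - u r * f v + v r * f u" for u v
    using omega_split[OF r arrow_source(1)[OF assms], of u v] by (simp add: C_def f_def)
  have 2: "omega d' u v = C u v + u r * f v - v r * f u" for u v
    using omega_split[OF r arrow_source(2)[OF assms], of u v] C' by (simp add: d'_def f_def)
  have reflect_f: "f (reflect r v) = f v" for v
    unfolding f_def by (intro sum.cong) auto
  have reflect_C: "C (reflect r u) (reflect r v) = C u v" for u v
    unfolding C_def by (intro sum.cong) auto
  have reflect_r: "reflect r v r = - v r - 2 * f v" for v
    using r by (simp add: reflect_def pair_def f_def sum.remove[of S r])
  show ?thesis
    unfolding d'_def[symmetric] 1 2 reflect_f reflect_C reflect_r by (simp add: algebra_simps)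
qed

lemma omega_sink_nonpos:
  assumes "source n d r" "pos v"
  shows "omega (d(r := d r + n)) (alpha r) v \<le> 0"
proof -
  have r: "r \<in> S" using assms by (simp add: source_def)
  have "omega (d(r := d r + n)) (alpha r) v = (\<Sum>b\<in>S - {r}. bil r b * v b)"
    using omega_split[OF r arrow_source(2)[OF assms(1)], of "alpha r" v] by (simp add: alpha_def)
  also have "\<dots> \<le> 0"
    using assms(2) bil_nonpos r by (intro sum_nonpos mult_nonpos_nonneg) (auto simp: pos_def)
  finally show ?thesis .
qed

section \<open>Firing sequences and their descents\<close>

text \<open>
  For a Coxeter word of length \<open>n\<close> in which \<open>a\<close> has position \<open>d a\<close>, this is the position in the
  infinite power of the first occurrence of \<open>a\<close> that \<open>ws\<close> has not used, provided that \<open>ws\<close> never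
  skips an occurrence of \<open>a\<close> and takes a later one.
\<close>

definition due :: "nat \<Rightarrow> ('a \<Rightarrow> nat) \<Rightarrow> 'a list \<Rightarrow> 'a \<Rightarrow> nat" where
  "due n d ws = (\<lambda>a. d a + n * count_list ws a)"

lemma due_Nil [simp]: "due n d [] = d"
  by (simp add: due_def)

lemma due_snoc: "due n d (ws @ [r]) = (due n d ws)(r := due n d ws r + n)"
  by (auto simp: due_def)

inductive firing :: "nat \<Rightarrow> ('a \<Rightarrow> nat) \<Rightarrow> 'a list \<Rightarrow> bool" for n d where
  firing_Nil: "firing n d []"
| firing_snoc: "firing n d ws \<Longrightarrow> source n (due n d ws) r \<Longrightarrow> firing n d (ws @ [r])"

text \<open>Only the coordinate at \<open>r\<close> changes, so every other one is both nonnegative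
  and nonpositive.\<close>

lemma reflect_neg_multiple:
  assumes "pos v" "neg (reflect r v)"
  shows "v = (\<lambda>x. v r * alpha r x)"
proof
  fix x
  show "v x = v r * alpha r x"
  proof (cases "x = r")
    case False
    have "reflect r v x \<le> 0" using assms(2) unfolding neg_def by blast
    then have "v x \<le> 0" using False by simp
    moreover have "0 \<le> v x" using assms(1) unfolding pos_def by blast
    ultimately show ?thesis using False by (simp add: alpha_def)
  qed (simp add: alpha_def)
qed

lemma omega_scale: "omega d (\<lambda>x. k * u x) v = k * omega d u v"
  by (simp add: omega_def sum_distrib_left algebra_simps)

text \<open>
  Pull both roots back through the last letters of \<open>ws\<close>, which preserves the form. At the letter
  \<open>r\<close> where the first root turns negative, it is a multiple of \<open>alpha r\<close>, and \<open>r\<close> is a sink.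
\<close>

lemma firing_omega_nonpos:
  assumes "firing n d ws" "a \<in> S" "b \<in> S" "reduced (ws @ v @ [b])"
    and "pos (act v (alpha a))" "neg (act (ws @ v) (alpha a))"
  shows "omega (due n d ws) (act v (alpha a)) (act v (alpha b)) \<le> 0"
  using assms
proof (induction arbitrary: v rule: firing.induct)
  case firing_Nil
  then have "set v \<subseteq> S" by (auto simp: reduced_def)
  then show ?case using firing_Nil not_pos_and_neg[of v a] by simp
next
  case (firing_snoc ws r)
  have r: "r \<in> S" using firing_snoc.hyps by (simp add: source_def)
  have red: "reduced (ws @ (r # v) @ [b])" using firing_snoc.prems by simp
  then have v: "set v \<subseteq> S" by (auto simp: reduced_def)
  let ?d = "due n d ws"
  show ?case
  proof (cases "pos (act (r # v) (alpha a))")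
    case True
    \<comment> \<open>Moving \<open>r\<close> from \<open>ws\<close> to \<open>v\<close> undoes the
      last firing, and \<open>omega_fire\<close> keeps the value of the form.\<close>
    have "omega ?d (act (r # v) (alpha a)) (act (r # v) (alpha b)) \<le> 0"
      using firing_snoc.prems red True by (intro firing_snoc.IH) auto
    then show ?thesis unfolding due_snoc omega_fire[OF firing_snoc.hyps(2)] by simp
  next
    case False
    then have "neg (act (r # v) (alpha a))"
      using pos_or_neg[of "r # v" a] r v firing_snoc.prems by auto
    then have mult: "act v (alpha a) = (\<lambda>x. act v (alpha a) r * alpha r x)"
      using firing_snoc.prems by (intro reflect_neg_multiple) auto
    \<comment> \<open>\<open>v @ [b]\<close> is a factor of a reduced word, so the second root is
      positive and the sink \<open>r\<close> pairs nonpositively with it.\<close>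
    have "reduced ((ws @ [r]) @ v @ [b])" using red by simp
    then have redb: "reduced (v @ [b])" by (rule reduced_appendD)
    then have "len (wprod v) < len (wprod v \<otimes> b)"
      using reduced_appendD(1)[OF redb] v firing_snoc.prems by (simp add: reduced_def)
    then have "pos (act v (alpha b))" using act_alpha_pos v firing_snoc.prems by simp
    then have "omega (due n d (ws @ [r])) (alpha r) (act v (alpha b)) \<le> 0"
      using omega_sink_nonpos[OF firing_snoc.hyps(2)] by (simp add: due_snoc)
    moreover have "0 \<le> act v (alpha a) r" using firing_snoc.prems by (simp add: pos_def)
    ultimately show ?thesis
      by (subst mult) (simp add: omega_scale mult_nonneg_nonpos)
  qed
qed

text \<open>The opposite order would make the entry of the form at \<open>a\<close> and
  \<open>b\<close> equal to \<open>- bil a b > 0\<close>, against \<open>firing_omega_nonpos\<close>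
  with empty \<open>v\<close>.\<close>

lemma firing_descent_not_before:
  assumes "firing n d ws" "a \<in> S" "b \<in> S" "reduced (ws @ [b])" "neg (act ws (alpha a))"
    and "a \<otimes> b \<noteq> b \<otimes> a"
  shows "\<not> due n d ws a < due n d ws b"
proof
  assume "due n d ws a < due n d ws b"
  then have "arrow (due n d ws) a b > 0"
    using bil_neg[of a b] assms by (simp add: arrow_def)
  moreover have "omega (due n d ws) (alpha a) (alpha b) \<le> 0"
    using firing_omega_nonpos[OF assms(1-3), of "[]"] assms by (simp add: pos_def alpha_def)
  ultimately show False using omega_alpha assms by simp
qed

text \<open>A source \<open>r\<close> commutes with all letters before it in a Coxeter word
  compatible with the orientation. So it moves to the front, and conjugation by \<open>r\<close>
  carries it to the end, where the new sink belongs.\<close>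

lemma firing_conjugate:
  assumes "firing n d ws" "distinct cs" "set cs = S"
    and "\<And>a b. prec cs a b \<Longrightarrow> d a < d b"
  shows "set ws \<subseteq> S \<and> (\<exists>ds. distinct ds \<and> set ds = S \<and> wprod ds = inv (wprod ws) \<otimes> wprod cs \<otimes> wprod ws \<and>
    (\<forall>a b. a \<otimes> b \<noteq> b \<otimes> a \<longrightarrow> prec ds a b \<longrightarrow> due n d ws a < due n d ws b))"
  using assms(1)
proof induction
  case firing_Nil
  then show ?case using assms by (auto intro!: exI[of _ cs])
next
  case (firing_snoc ws r)
  then obtain ds where ws: "set ws \<subseteq> S" and ds: "distinct ds" "set ds = S"
    "wprod ds = inv (wprod ws) \<otimes> wprod cs \<otimes> wprod ws"
    "\<And>a b. a \<otimes> b \<noteq> b \<otimes> a \<Longrightarrow> prec ds a b \<Longrightarrow> due n d ws a < due n d ws b"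
    by blast
  have r: "r \<in> S" using firing_snoc.hyps by (simp add: source_def)
  obtain p q where pq: "ds = p @ r # q" using r ds split_list by metis
  have sub: "set p \<subseteq> S" "set q \<subseteq> S" using pq ds by auto
  \<comment> \<open>A noncommuting letter before \<open>r\<close> would be due before the source
    \<open>r\<close>.\<close>
  have "r \<otimes> x = x \<otimes> r" if x: "x \<in> set p" for x
  proof (rule ccontr)
    assume nc: "r \<otimes> x \<noteq> x \<otimes> r"
    have "due n d ws x < due n d ws r"
      using ds(4)[of x r] nc x by (auto simp: pq prec_append)
    moreover have "due n d ws r < due n d ws x"
      using firing_snoc.hyps(2) nc x sub by (auto simp: source_def)
    ultimately show False by simp
  qed
  then have "r \<otimes> wprod p = wprod p \<otimes> r" using r sub by (intro commute_wprod) auto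
  moreover have "r \<otimes> wprod ds = (r \<otimes> wprod p) \<otimes> (r \<otimes> wprod q)"
    using pq r sub by (simp add: m_assoc)
  ultimately have "r \<otimes> wprod ds = wprod p \<otimes> wprod q"
    using r sub by (simp add: m_assoc)
  then have "wprod (p @ q @ [r]) = r \<otimes> wprod ds \<otimes> r"
    using r sub by (simp add: m_assoc)
  also have "\<dots> = inv (wprod (ws @ [r])) \<otimes> wprod cs \<otimes> wprod (ws @ [r])"
    using r ws assms(3) by (simp add: ds(3) inv_mult_group m_assoc)
  finally have 1: "wprod (p @ q @ [r]) = inv (wprod (ws @ [r])) \<otimes> wprod cs \<otimes> wprod (ws @ [r])" .
  \<comment> \<open>Only \<open>r\<close> changes its due position; the upper bound in
    \<open>source\<close> places it after all its neighbors.\<close>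
  have 2: "due n d (ws @ [r]) a < due n d (ws @ [r]) b"
    if nc: "a \<otimes> b \<noteq> b \<otimes> a" and pr: "prec (p @ q @ [r]) a b" for a b
  proof -
    have ab: "a \<in> S" "b \<in> S" "a \<noteq> b" using prec_set[OF pr] sub r nc by auto
    show ?thesis
    proof (cases "b = r")
      case True
      then show ?thesis using ab nc firing_snoc.hyps(2) by (auto simp: due_snoc source_def)
    next
      case False
      then have "prec (p @ q) a b" using pr by (auto simp: prec_append)
      then have "prec ds a b" "a \<noteq> r"
        using pq ds(1) by (auto simp: prec_append dest: prec_set)
      then show ?thesis using ds(4) nc False by (simp add: due_snoc)
    qed
  qed
  show ?case
    using 1 2 ds pq ws r by (intro conjI exI[of _ "p @ q @ [r]"]) (auto simp del: wprod_append)
qed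

end

section \<open>The sorting word of the longest element\<close>

lemma filter_less_Suc:
  fixes ps :: "nat list"
  assumes "sorted_wrt (<) ps"
  shows "filter (\<lambda>i. i < Suc k) ps = filter (\<lambda>i. i < k) ps @ (if k \<in> set ps then [k] else [])"
  using assms
proof (induction ps)
  case (Cons p ps)
  consider "p < k" | "p = k" | "k < p" by linarith
  then show ?case
  proof cases
    case 1
    then show ?thesis using Cons by auto
  next
    case 2
    then have "filter (\<lambda>i. i < Suc k) ps = []" "filter (\<lambda>i. i < k) ps = []"
      using Cons.prems by (auto simp: filter_empty_conv)
    then show ?thesis using 2 by auto
  next
    case 3
    then have "filter (\<lambda>i. i < Suc k) ps = []" "filter (\<lambda>i. i < k) ps = []" "k \<notin> set ps"
      using Cons.prems by (auto simp: filter_empty_conv)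
    then show ?thesis using 3 by auto
  qed
qed simp

lemma filter_less_append:
  fixes ps :: "nat list"
  assumes "sorted_wrt (<) ps"
  shows "ps = filter (\<lambda>i. i < k) ps @ filter (\<lambda>i. k \<le> i) ps"
  using assms
proof (induction ps)
  case (Cons p ps)
  show ?case
  proof (cases "p < k")
    case False
    then have "filter (\<lambda>i. i < k) ps = []" using Cons.prems by (auto simp: filter_empty_conv)
    then show ?thesis using False Cons by auto
  qed (use Cons in auto)
qed simp

lemma power_subword_append:
  "power_subword cs (ps @ qs) = power_subword cs ps @ power_subword cs qs"
  by (simp add: power_subword_def)

lemma length_power_subword [simp]: "length (power_subword cs ps) = length ps"
  by (simp add: power_subword_def)

lemma ex_power_subword_from:
  assumes "set u \<subseteq> set cs"
  shows "\<exists>qs. sorted_wrt (<) qs \<and> (\<forall>q\<in>set qs. k \<le> q) \<and> power_subword cs qs = u"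
  using assms
proof (induction u arbitrary: k)
  case (Cons x u)
  then obtain i where i: "i < length cs" "cs ! i = x" by (auto simp: in_set_conv_nth)
  \<comment> \<open>The copy of \<open>cs\<close> with index \<open>k\<close> starts no earlier than
    position \<open>k\<close>, as \<open>cs\<close> is nonempty.\<close>
  define q where "q = length cs * k + i"
  have "1 * k \<le> length cs * k" using i by (intro mult_le_mono1) auto
  then have "k \<le> q" unfolding q_def by linarith
  moreover have "q mod length cs = i" using i by (simp add: q_def)
  ultimately have q: "k \<le> q" "q mod length cs = i" by auto
  obtain qs where qs: "sorted_wrt (<) qs" "\<forall>p\<in>set qs. Suc q \<le> p" "power_subword cs qs = u"
    using Cons.IH[of "Suc q"] Cons.prems by auto
  then show ?case
    using q i by (intro exI[of _ "q # qs"]) (force simp: power_subword_def)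
qed (simp add: power_subword_def)

text \<open>These are due positions after \<open>i\<close> and \<open>j\<close> rounds. Being less
  than a round apart in the initial order leaves no room for a difference in rounds.\<close>

lemma round_count_eq:
  fixes x y n i j :: nat
  assumes "x < y" "y < n" "x + n * i < y + n * j" "y + n * j < x + n * i + n"
  shows "i = j"
proof (rule ccontr)
  assume "i \<noteq> j"
  then consider "Suc i \<le> j" | "Suc j \<le> i" by linarith
  then show False
  proof cases
    case 1
    then have "n * Suc i \<le> n * j" by (rule mult_le_mono2)
    then show ?thesis using assms by simp
  next
    case 2
    then have "n * Suc j \<le> n * i" by (rule mult_le_mono2)
    then show ?thesis using assms by simp
  qed
qed

text \<open>The reversed order means that the letter with the smaller start is exactly one round
  ahead.\<close>

lemma round_count_Suc:
  fixes x y n i j :: nat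
  assumes "x < y" "y < n" "y + n * j < x + n * i" "x + n * i < y + n * j + n"
  shows "i = Suc j"
proof (rule ccontr)
  assume "i \<noteq> Suc j"
  then consider "i \<le> j" | "Suc (Suc j) \<le> i" by linarith
  then show False
  proof cases
    case 1
    then have "n * i \<le> n * j" by (rule mult_le_mono2)
    then show ?thesis using assms by linarith
  next
    case 2
    then have "n * Suc (Suc j) \<le> n * i" by (rule mult_le_mono2)
    then show ?thesis using assms by simp
  qed
qed

context finite_coxeter_system
begin

text \<open>If \<open>r\<close> lengthened \<open>g\<close>, then \<open>g @ [r]\<close> would
  extend to a reduced word of \<open>w0\<close> with all further positions after \<open>k\<close>.
  This position list would be lexicographically smaller than \<open>ps\<close>.\<close>

lemma sorting_positions_greedy:
  assumes w0: "longest_element W S w0" and cs: "set cs = S" "cs \<noteq> []"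
    and ps: "reduced_positions W S cs w0 ps"
    and least: "\<And>qs. reduced_positions W S cs w0 qs \<Longrightarrow> qs = ps \<or> (ps, qs) \<in> lexord less_than"
    and g: "g = power_subword cs (filter (\<lambda>i. i < k) ps)"
    and r: "r = cs ! (k mod length cs)"
    and notin: "k \<notin> set ps"
  shows "\<not> len (wprod g) < len (wprod g \<otimes> r)"
proof
  assume up: "len (wprod g) < len (wprod g \<otimes> r)"
  let ?F = "filter (\<lambda>i. i < k) ps" and ?R = "filter (\<lambda>i. k \<le> i) ps"
  have sorted: "sorted_wrt (<) ps" and red: "reduced (power_subword cs ps)"
    and prod: "wprod (power_subword cs ps) = w0"
    using ps by (auto simp: reduced_positions_def reduced_word_iff)
  have split: "ps = ?F @ ?R" by (rule filter_less_append[OF sorted])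
  have "power_subword cs ps = g @ power_subword cs ?R"
    unfolding g power_subword_append[symmetric] split[symmetric] ..
  then have redg: "reduced g" using red reduced_appendD(1) by metis
  then have gS: "set g \<subseteq> S" "len (wprod g) = length g" by (auto simp: reduced_def)
  have rS: "r \<in> S" unfolding r cs(1)[symmetric] using cs(2) by (intro nth_mem) simp
  \<comment> \<open>The missing factor of \<open>w0\<close>; by \<open>len_inv_mult_w0\<close> its
    length is exactly what remains.\<close>
  define h where "h = inv (wprod g \<otimes> r) \<otimes> w0"
  have w0c: "w0 \<in> carrier W" by (rule w0_carrier[OF w0])
  have hc: "h \<in> carrier W" using gS rS w0c by (simp add: h_def)
  have lenh: "len h + Suc (length g) = len w0"
    using len_inv_mult_w0[OF w0, of "wprod g \<otimes> r"] len_mult_S[of "wprod g" r] up gS rS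
    by (auto simp: h_def)
  obtain u where u: "set u \<subseteq> S" "wprod u = h" "length u = len h" using ex_reduced[OF hc] by blast
  obtain us where us: "sorted_wrt (<) us" "\<forall>q\<in>set us. Suc k \<le> q" "power_subword cs us = u"
    using ex_power_subword_from[of u cs "Suc k"] u cs by auto
  define qs where "qs = ?F @ k # us"
  have "power_subword cs qs = g @ r # u"
    using us by (simp add: qs_def power_subword_append g r) (simp add: power_subword_def)
  moreover have "wprod (g @ r # u) = w0"
  proof -
    have "wprod (g @ r # u) = (wprod g \<otimes> r) \<otimes> (inv (wprod g \<otimes> r) \<otimes> w0)"
      using gS rS u w0c by (simp add: h_def m_assoc)
    also have "\<dots> = w0" using gS rS w0c by (simp add: m_assoc[symmetric])
    finally show ?thesis .
  qed
  moreover have "sorted_wrt (<) qs"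
    using us sorted by (fastforce simp: qs_def sorted_wrt_append sorted_wrt_filter)
  ultimately have "reduced_positions W S cs w0 qs"
    using gS rS u lenh by (simp add: reduced_positions_def reduced_word_iff reduced_def)
  then have "qs = ps \<or> (ps, qs) \<in> lexord less_than" by (rule least)
  moreover have "qs \<noteq> ps"
  proof -
    have "k \<in> set qs" by (simp add: qs_def)
    then show ?thesis using notin by blast
  qed
  ultimately have "(?F @ ?R, ?F @ k # us) \<in> lexord less_than"
    unfolding split[symmetric] qs_def[symmetric] by blast
  then have lex: "(?R, k # us) \<in> lexord less_than" by (rule lexord_append_leftD) simp
  show False
  proof (cases ?R)
    case Nil
    \<comment> \<open>With no positions left \<open>g\<close> already spells \<open>w0\<close>,
      which no letter lengthens.\<close>
    then have "?F = ps" using split by (metis append_Nil2)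
    then have "wprod g = w0" using prod g by simp
    then show ?thesis using up len_le_w0[OF w0, of "wprod g \<otimes> r"] gS rS w0c by simp
  next
    case (Cons y ys)
    then have "y \<in> set ?R" by simp
    then have "k \<le> y" "y \<noteq> k" using notin by auto
    then show ?thesis using lex Cons by simp
  qed
qed

lemma sorting_word_counts:
  assumes c: "coxeter_element W S c" "reduced_word W S c cs"
    and w0: "longest_element W S w0" and sw: "sorting_word W S cs w0 ws"
    and st: "neighbors W S s t" "comes_before W S c s t"
  shows "comes_before W S c (psi W w0 s) (psi W w0 t) \<Longrightarrow> count_list ws s = count_list ws t"
    and "comes_before W S c (psi W w0 t) (psi W w0 s) \<Longrightarrow> count_list ws s = count_list ws t + 1"
proof -
  have s: "s \<in> S" and t: "t \<in> S" and nc: "s \<otimes> t \<noteq> t \<otimes> s"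
    using st by (auto simp: neighbors_def)
  have cs: "distinct cs" "set cs = S" "wprod cs = c"
    using reduced_word_of_coxeter_element[OF c] c by (auto simp: reduced_word_iff)
  define n where "n = length cs"
  have n: "n > 0" using cs s by (auto simp: n_def)
  define d where "d = inv_into {..<n} (nth cs)"
  have d_nth: "d (cs ! i) = i" if "i < n" for i
    unfolding d_def using that cs by (intro inv_into_f_f) (auto simp: n_def inj_on_nth)
  have d: "d a < n" "cs ! d a = a" if a: "a \<in> S" for a
  proof -
    obtain i where "i < n" "cs ! i = a" using a in_set_conv_nth[of a cs] cs(2) by (auto simp: n_def)
    then show "d a < n" "cs ! d a = a" using d_nth by auto
  qed
  have d_prec: "d a < d b" if "prec cs a b" for a b
    using that d_nth by (auto simp: prec_iff_nth n_def)
  obtain ps where ps: "reduced_positions W S cs w0 ps" "ws = power_subword cs ps"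
    and least: "\<And>qs. reduced_positions W S cs w0 qs \<Longrightarrow> qs = ps \<or> (ps, qs) \<in> lexord less_than"
    using sw by (auto simp: sorting_word_def)
  have sorted: "sorted_wrt (<) ps" and red: "reduced ws" and prod: "wprod ws = w0"
    using ps by (auto simp: reduced_positions_def reduced_word_iff)
  define g where "g k = power_subword cs (filter (\<lambda>i. i < k) ps)" for k
  have red_g: "reduced (g k)" for k
  proof -
    have "reduced (g k @ power_subword cs (filter (\<lambda>i. k \<le> i) ps))"
      unfolding g_def power_subword_append[symmetric] filter_less_append[OF sorted, symmetric]
      using red ps by simp
    then show ?thesis by (rule reduced_appendD)
  qed
  then have gS: "set (g k) \<subseteq> S" for k by (simp add: reduced_def)
  let ?D = "\<lambda>k. due n d (g k)"
  have D_mod: "?D k a mod n = d a" if "a \<in> S" for k a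
    using d(1)[OF that] by (simp add: due_def)
  \<comment> \<open>The letters \<open>a\<close> with \<open>due n d (g k) a < k\<close> are those that have been skipped; none is taken again.\<close>
  have inv: "firing n d (g k) \<and> (\<forall>a\<in>S. ?D k a < k + n) \<and>
    (\<forall>a\<in>S. ?D k a < k \<longrightarrow> neg (act (g k) (alpha a))) \<and>
    (\<forall>a\<in>S. \<forall>b\<in>S. a \<otimes> b \<noteq> b \<otimes> a \<longrightarrow> ?D k a < ?D k b + n)" for k
  proof (induction k)
    case 0
    have "g 0 = []" by (simp add: g_def power_subword_def)
    then show ?case using d by (auto intro: firing_Nil trans_less_add2)
  next
    case (Suc k)
    \<comment> \<open>\<open>lt\<close> and \<open>dead\<close> pin a taken letter to its due
      position; \<open>close\<close> gives the alternation of neighbors at the end.\<close>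
    then have fire: "firing n d (g k)" and lt: "\<And>a. a \<in> S \<Longrightarrow> ?D k a < k + n"
      and dead: "\<And>a. a \<in> S \<Longrightarrow> ?D k a < k \<Longrightarrow> neg (act (g k) (alpha a))"
      and close: "\<And>a b. a \<in> S \<Longrightarrow> b \<in> S \<Longrightarrow> a \<otimes> b \<noteq> b \<otimes> a \<Longrightarrow> ?D k a < ?D k b + n"
      by blast+
    define r where "r = cs ! (k mod n)"
    have r: "r \<in> S" using n cs by (auto simp: r_def n_def)
    have dr: "d r = k mod n" using n by (simp add: r_def d_nth)
    have eq_r: "a = r" if "a \<in> S" "?D k a = k" for a
      using D_mod[OF that(1), of k] that d(2)[OF that(1)] by (simp add: r_def)
    show ?case
    proof (cases "k \<in> set ps")
      case True
      then have g': "g (Suc k) = g k @ [r]"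
        by (simp add: g_def filter_less_Suc[OF sorted] power_subword_append)
          (simp add: power_subword_def r_def n_def)
      have red': "reduced (g k @ [r])" using red_g[of "Suc k"] g' by simp
      then have "len (wprod (g k)) < len (wprod (g k) \<otimes> r)"
        using red_g[of k] gS r by (simp add: reduced_def)
      then have pos_r: "pos (act (g k) (alpha r))" using act_alpha_pos gS r by simp
      \<comment> \<open>A lengthening letter is not a skipped one, so it is due in
        \<open>[k, k + n)\<close>, where its residue modulo \<open>n\<close> leaves only
        \<open>k\<close>.\<close>
      have Dr: "?D k r = k"
      proof -
        have "\<not> ?D k r < k" using dead[OF r] not_pos_and_neg[OF gS pos_r] by blast
        moreover have "(k + (?D k r - k)) mod n = k mod n"
          using D_mod[OF r, of k] dr calculation by simp
        then have "n dvd ?D k r - k"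
          by (metis add_diff_cancel_left' le_add1 mod_eq_dvd_iff_nat)
        then have "?D k r - k = 0" using lt[OF r] n by (auto dest!: dvd_imp_le)
        ultimately show ?thesis by simp
      qed
      \<comment> \<open>A neighbor due before \<open>k\<close> would be a descent due before
        \<open>r\<close>, excluded by \<open>firing_descent_not_before\<close>; position
        \<open>k\<close> itself belongs to \<open>r\<close>.\<close>
      have nbr: "k < ?D k b" if b: "b \<in> S" "b \<otimes> r \<noteq> r \<otimes> b" for b
      proof -
        have "\<not> ?D k b < k"
          using firing_descent_not_before[OF fire b(1) r red'] dead[OF b(1)] b Dr by auto
        moreover have "?D k b \<noteq> k" using eq_r[OF b(1)] b(2) by auto
        ultimately show ?thesis by simp
      qed
      have source: "source n (?D k) r"
        unfolding source_def using r nbr lt Dr by metis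
      have D': "?D (Suc k) = (?D k)(r := k + n)" by (simp add: g' due_snoc Dr)
      \<comment> \<open>A skipped letter is not a neighbor of \<open>r\<close> by
        \<open>nbr\<close>, so \<open>r\<close> fixes its root and the sign persists.\<close>
      have "neg (act (g (Suc k)) (alpha a))" if a: "a \<in> S" "?D (Suc k) a < Suc k" for a
      proof -
        have ar: "a \<noteq> r" using a(2) n by (auto simp: D')
        then have "?D k a < k" using a eq_r[OF a(1)] by (force simp: D')
        then have "r \<otimes> a = a \<otimes> r" using nbr[OF a(1)] by force
        then have "act (g (Suc k)) (alpha a) = act (g k) (alpha a)"
          using reflect_alpha_commute[OF r a(1)] ar by (simp add: g')
        then show ?thesis using dead[OF a(1) \<open>?D k a < k\<close>] by simp
      qed
      moreover have "?D (Suc k) a < ?D (Suc k) b + n"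
        if "a \<in> S" "b \<in> S" "a \<otimes> b \<noteq> b \<otimes> a" for a b
        using close[OF that] lt[OF that(1)] nbr[of b] that by (auto simp: D')
      moreover have "?D (Suc k) a < Suc k + n" if "a \<in> S" for a
        using lt[OF that] by (simp add: D')
      moreover have "firing n d (g (Suc k))" unfolding g' using fire source by (rule firing_snoc)
      ultimately show ?thesis by blast
    next
      case False
      then have g': "g (Suc k) = g k" by (simp add: g_def filter_less_Suc[OF sorted])
      have "\<not> len (wprod (g k)) < len (wprod (g k) \<otimes> r)"
        using n False ps(1) least
        by (intro sorting_positions_greedy[OF w0 cs(2), of ps "g k" k r]) (auto simp: g_def r_def n_def)
      then have "neg (act (g k) (alpha r))"
        using pos_or_neg[OF gS r, of k] act_alpha_pos_iff[OF gS r, of k] by blast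
      \<comment> \<open>A letter due before \<open>Suc k\<close> but not before \<open>k\<close> can
        only be \<open>r\<close>, which greediness makes a descent.\<close>
      then have "neg (act (g k) (alpha a))" if "a \<in> S" "?D k a < Suc k" for a
        using dead eq_r that less_Suc_eq by metis
      then show ?thesis using fire lt close unfolding g' by (auto intro: less_SucI)
    qed
  qed
  obtain k where "\<forall>p\<in>set ps. p < k" using finite_nat_set_iff_bounded[of "set ps"] by auto
  then have gk: "g k = ws" using ps by (simp add: g_def)
  note fin = inv[of k, unfolded gk]
  have close: "due n d ws s < due n d ws t + n" "due n d ws t < due n d ws s + n"
    using fin s t nc by (metis, metis)
  obtain ds where ds: "distinct ds" "set ds = S" "wprod ds = inv (wprod ws) \<otimes> wprod cs \<otimes> wprod ws"
    "\<And>a b. a \<otimes> b \<noteq> b \<otimes> a \<Longrightarrow> prec ds a b \<Longrightarrow> due n d ws a < due n d ws b"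
    using firing_conjugate[of n d ws cs] fin cs d_prec by blast
  \<comment> \<open>A second Coxeter word for the conjugate of \<open>c\<close> by
    \<open>w0\<close>; comparing it with \<open>ds\<close> relates \<open>psi\<close> to the final
    due positions.\<close>
  define es where "es = map (psi W w0) cs"
  have psi2: "psi W w0 (psi W w0 x) = x" if "x \<in> carrier W" for x
    using psi_psi[OF w0 that] .
  have inj: "inj_on (psi W w0) S" by (metis S_carrier inj_onI psi2)
  have "psi W w0 ` S = S"
    using psi_S[OF w0] psi2 by (metis S_carrier image_eqI image_subsetI subsetI subset_antisym)
  then have es: "distinct es" "set es = S" using cs inj by (auto simp: es_def distinct_map)
  have "wprod es = wprod ds"
    using wprod_map_psi[OF w0, of cs] cs by (simp add: es_def ds(3) prod psi_def)
  then have es_ds: "prec ds a b" if "prec es a b" "a \<otimes> b \<noteq> b \<otimes> a" for a b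
    using prec_wprod_cong[OF es(1) ds(1), of a b] es ds that by simp
  have end_order: "due n d ws a < due n d ws b"
    if ab: "a \<in> S" "b \<in> S" "a \<otimes> b \<noteq> b \<otimes> a" and cb: "comes_before W S c (psi W w0 a) (psi W w0 b)" for a b
  proof -
    have "psi W w0 a \<otimes> psi W w0 b \<noteq> psi W w0 b \<otimes> psi W w0 a"
    proof
      assume "psi W w0 a \<otimes> psi W w0 b = psi W w0 b \<otimes> psi W w0 a"
      then have "psi W w0 (psi W w0 (a \<otimes> b)) = psi W w0 (psi W w0 (b \<otimes> a))"
        using psi_mult[OF w0] ab by simp
      then show False using ab psi2 by simp
    qed
    \<comment> \<open>Applying the involution \<open>psi\<close> letterwise turns the order of
      \<open>psi a\<close> and \<open>psi b\<close> in \<open>cs\<close> into that of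
      \<open>a\<close> and \<open>b\<close> in \<open>es\<close>.\<close>
    then have "prec cs (psi W w0 a) (psi W w0 b)"
      using comes_before_iff_prec[OF c] cb by blast
    then have "prec es a b"
      using prec_map[of cs "psi W w0 a" "psi W w0 b" "psi W w0"] psi2 ab by (simp add: es_def)
    then show ?thesis using es_ds ds(4) ab by blast
  qed
  have dst: "d s < d t" "d t < n"
    using d_prec comes_before_iff_prec[OF c nc] st(2) d(1)[OF t] by auto
  show "count_list ws s = count_list ws t" if "comes_before W S c (psi W w0 s) (psi W w0 t)"
    using round_count_eq[OF dst] end_order[OF s t nc that] close by (simp add: due_def)
  show "count_list ws s = count_list ws t + 1" if "comes_before W S c (psi W w0 t) (psi W w0 s)"
    using round_count_Suc[OF dst] end_order[OF t s nc[symmetric] that] close by (simp add: due_def)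
qed

end

theorem theorem7p2:
  fixes W :: "('a, 'b) monoid_scheme" and S :: "'a set"
    and c w0 s t :: 'a and cs ws :: "'a list"
  assumes "coxeter_system W S" and "finite (carrier W)"
    and "coxeter_element W S c" and "reduced_word W S c cs"
    and "longest_element W S w0" and "sorting_word W S cs w0 ws"
    and "neighbors W S s t" and "comes_before W S c s t"
  shows "(comes_before W S c (psi W w0 s) (psi W w0 t) \<longrightarrow>
            count_list ws s = count_list ws t) \<and>
         (comes_before W S c (psi W w0 t) (psi W w0 s) \<longrightarrow>
            count_list ws s = count_list ws t + 1)"
proof -
  interpret finite_coxeter_system W S
    using assms(1,2) by (simp add: finite_coxeter_system_def finite_coxeter_system_axioms_def)
  show ?thesis using sorting_word_counts[OF assms(3-8)] by blast
qed

end
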